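(* Assume that $\Pi_{N,E}\Rightarrow\Pi_E$ weakly for some probability measure $\Pi_E$ on $\Delta(\mathcal X)$; that $\operatorname{supp}\Pi\subseteq\{\mu:\min_x\mu(x)>0\}$; and that $\mathbb P_\mu(E_N)=e^{-N I_E(\mu)+o(N)}$ with the $o(N)$ uniform over $\mu\in\operatorname{supp}\Pi$ (i.e. $\sup_{\mu\in\operatorname{supp}\Pi}|\tfrac1N\log\mathbb P_\mu(E_N)+I_E(\mu)|\to0$). Write $I^\star=\inf_{\operatorname{supp}\Pi}I_E$ (which is finite); note that $I_E$ vanishes exactly on $E$. Then: (i) (Support.) $\Pi_E$ is carried by $\arg\min_{\operatorname{supp}\Pi}I_E=\{\mu\in\operatorname{supp}\Pi:I_E(\mu)=I^\star\}$. (ii) (Reachable.) If $I^\star=0$, then $\Pi_E$ is carried by $E$ and $T_E=\mathrm{id}$ $\Pi_E$-almost surely, so $\widetilde\Pi_E=\Pi_E$. (iii) (Unreachable.) If $I^\star>0$, then $P^\star_\mu\ne\mu$ for $\Pi_E$-almost every $\mu$. (iv) (Degeneracy.) Suppose in addition that $E$ is affine, i.e. $E=\{Q\in\Delta(\mathcal X):\langle g_j,Q\rangle=\alpha_j,\ j\le r_0\}$ (no inequality constraints), that every $\mu\in\operatorname{supp}\Pi_E$ is strictly positive with strictly positive $I$-projection $P^\star_\mu$, and that $g_1,\dots,g_{r_0}$ have rank $r_0$ modulo constants (that is, $1,g_1,\dots,g_{r_0}$ are linearly independent functions on $\mathcal X$). Then, for $\mu,\nu\in\operatorname{supp}\Pi_E$,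 $P^\star_\mu=P^\star_\nu$ if and only if $\mu$ and $\nu$ lie in the same tilt orbit of the exponential family generated by $g_1,\dots,g_{r_0}$. Hence $\widetilde\Pi_E$ is degenerate (a point mass) if and only if $\operatorname{supp}\Pi_E$ lies in a single tilt orbit; otherwise the randomness of $\widetilde\Pi_E$ is that of the tilt orbit of $\mu\sim\Pi_E$ (the component of $\Pi_E$ transverse to the tilt family), the orbit space (of the strictly positive laws on $\mathcal X$) having dimension $k-1-r_0$.
   Context: Let $\mathcal X=\{1,\dots,k\}$, $\Delta(\mathcal X)$ the probability simplex, $D(Q\|\mu)=\sum_xQ(x)\log\{Q(x)/\mu(x)\}$ ($=+\infty$ if $Q\not\ll\mu$), $\langle g,Q\rangle=\sum_xg(x)Q(x)$. Given $g_1,\dots,g_r:\mathcal X\to\mathbb R$, $\alpha_j\in\mathbb R$, $0\le r_0\le r$, let $$E=\{Q\in\Delta(\mathcal X):\langle g_j,Q\rangle=\alpha_j\ (j\le r_0),\ \langle g_j,Q\rangle\ge\alpha_j\ (r_0<j\le r)\}\ne\varnothing,$$ $$E_\varepsilon=\{Q\in\Delta(\mathcal X):|\langle g_j,Q\rangle-\alpha_j|\le\varepsilon\ (j\le r_0),\ \langle g_j,Q\rangle\ge\alpha_j-\varepsilon\ (r_0<j\le r)\},$$ and let $\varepsilon_N>0$, $\varepsilon_N\to0$. Let $\Pi$ (the prior) be a probability measure on $\Delta(\mathcal X)$. Under $\mathbb P_\mu$, $X_1,\dots,X_N$ are i.i.d. $\mu$; $\widehat P_N=\frac1N\sum_{i\le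 N}\delta_{X_i}$, $E_N=\{\widehat P_N\in E_{\varepsilon_N}\}$. The constraint posterior is $\Pi_{N,E}(d\mu)=\mathbb P_\mu(E_N)\Pi(d\mu)/\int\mathbb P_\nu(E_N)\Pi(d\nu)$ (for $N$ large enough that the denominator is positive). $I_E(\mu)=\inf_{Q\in E}D(Q\|\mu)$; $T_E(\mu)=P^\star_\mu=\arg\min_{Q\in E}D(Q\|\mu)$ is the $I$-projection (unique where the minimum is finite); $\widetilde\Pi_E=(T_E)_\#\Pi_E$ is the pushforward. Two strictly positive laws $\mu,\nu$ lie in the same tilt orbit of the exponential family generated by $g_1,\dots,g_{r_0}$ if $\nu(x)=\mu(x)e^{\theta^\top g(x)}/\sum_y\mu(y)e^{\theta^\top g(y)}$ for some $\theta\in\mathbb R^{r_0}$, where $g=(g_1,\dots,g_{r_0})$. *)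

theory Defs
  imports "HOL-Analysis.Analysis" "HOL-Probability.Probability"
begin

text \<open>
  The alphabet is a finite type \<open>'k\<close>, so \<open>k = CARD('k)\<close>. Functions and laws on it are vectors in
  \<open>real ^ 'k\<close>, and the pairing of a function \<open>g\<close> with a law \<open>Q\<close> is the inner product \<open>g \<bullet> Q\<close>.
\<close>

definition prob_simplex :: "(real ^ 'k) set" where
  "prob_simplex = {p. (\<forall>x. 0 \<le> p $ x) \<and> (\<Sum>x\<in>UNIV. p $ x) = 1}"

definition pos_laws :: "(real ^ 'k) set" where
  "pos_laws = {p \<in> prob_simplex. \<forall>x. 0 < p $ x}"

abbreviation simplex_borel :: "(real ^ 'k) measure" where
  "simplex_borel \<equiv> restrict_space borel prob_simplex"

text \<open>The convention \<open>0 log (0 / m) = 0\<close> is automatic in the finite sum, including for \<open>m = 0\<close>.\<close>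

definition rel_entropy :: "real ^ 'k \<Rightarrow> real ^ 'k \<Rightarrow> ereal" where
  "rel_entropy Q \<mu> =
     (if \<forall>x. \<mu> $ x = 0 \<longrightarrow> Q $ x = 0
      then ereal (\<Sum>x\<in>UNIV. Q $ x * ln (Q $ x / \<mu> $ x))
      else \<infinity>)"

definition constraint_set ::
    "nat \<Rightarrow> nat \<Rightarrow> (nat \<Rightarrow> real ^ 'k) \<Rightarrow> (nat \<Rightarrow> real) \<Rightarrow> (real ^ 'k) set" where
  "constraint_set r0 r g \<alpha> =
     {Q \<in> prob_simplex. (\<forall>j\<in>{1..r0}. g j \<bullet> Q = \<alpha> j) \<and> (\<forall>j\<in>{r0<..r}. g j \<bullet> Q \<ge> \<alpha> j)}"

definition relaxed_constraint_set ::
    "nat \<Rightarrow> nat \<Rightarrow> (nat \<Rightarrow> real ^ 'k) \<Rightarrow> (nat \<Rightarrow> real) \<Rightarrow> real \<Rightarrow> (real ^ 'k) set" where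
  "relaxed_constraint_set r0 r g \<alpha> e =
     {Q \<in> prob_simplex. (\<forall>j\<in>{1..r0}. \<bar>g j \<bullet> Q - \<alpha> j\<bar> \<le> e) \<and>
                        (\<forall>j\<in>{r0<..r}. g j \<bullet> Q \<ge> \<alpha> j - e)}"

definition rate :: "(real ^ 'k) set \<Rightarrow> real ^ 'k \<Rightarrow> ereal" where
  "rate E \<mu> = (INF Q\<in>E. rel_entropy Q \<mu>)"

text \<open>
  Where the minimum is infinite every point of \<open>E\<close> is a minimizer, and \<open>arg_min_on\<close> returns some
  fixed element of \<open>E\<close>.
\<close>

definition I_proj :: "(real ^ 'k) set \<Rightarrow> real ^ 'k \<Rightarrow> real ^ 'k" where
  "I_proj E \<mu> = arg_min_on (\<lambda>Q. rel_entropy Q \<mu>) E"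

definition law_measure :: "real ^ 'k \<Rightarrow> 'k measure" where
  "law_measure \<mu> = point_measure UNIV (\<lambda>x. ennreal (\<mu> $ x))"

definition sample_measure :: "nat \<Rightarrow> real ^ 'k \<Rightarrow> (nat \<Rightarrow> 'k) measure" where
  "sample_measure N \<mu> = PiM {1..N} (\<lambda>_. law_measure \<mu>)"

text \<open>\<open>axis x 1\<close> is the point mass at \<open>x\<close>.\<close>

definition empirical :: "nat \<Rightarrow> (nat \<Rightarrow> 'k) \<Rightarrow> real ^ 'k" where
  "empirical N \<omega> = (1 / real N) *\<^sub>R (\<Sum>i=1..N. axis (\<omega> i) 1)"

definition prob_empirical_in :: "nat \<Rightarrow> (real ^ 'k) set \<Rightarrow> real ^ 'k \<Rightarrow> real" where
  "prob_empirical_in N A \<mu> =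
     measure (sample_measure N \<mu>) {\<omega> \<in> space (sample_measure N \<mu>). empirical N \<omega> \<in> A}"

text \<open>If the normalizing integral vanishes, this is the zero measure.\<close>

definition constraint_posterior ::
    "(real ^ 'k) measure \<Rightarrow> nat \<Rightarrow> (real ^ 'k) set \<Rightarrow> (real ^ 'k) measure" where
  "constraint_posterior prior N A =
     density prior (\<lambda>\<mu>. ennreal (prob_empirical_in N A \<mu>) /
                        (\<integral>\<^sup>+ \<nu>. ennreal (prob_empirical_in N A \<nu>) \<partial>prior))"

text \<open>Unlike \<open>ln\<close>, which is \<open>0\<close> at \<open>0\<close>, this logarithm sends a vanishing probability to \<open>-\<infinity>\<close>.\<close>

definition log_prob :: "real \<Rightarrow> ereal" where
  "log_prob p = (if 0 < p then ereal (ln p) else - \<infinity>)"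

definition msupp :: "'a::topological_space measure \<Rightarrow> 'a set" where
  "msupp M = {x \<in> space M. \<forall>U. open U \<longrightarrow> x \<in> U \<longrightarrow> 0 < emeasure M (U \<inter> space M)}"

definition weakly_converges ::
    "(nat \<Rightarrow> 'a::topological_space measure) \<Rightarrow> 'a measure \<Rightarrow> bool" where
  "weakly_converges Ms M \<longleftrightarrow>
     (\<forall>f :: 'a \<Rightarrow> real. continuous_on (space M) f \<longrightarrow> bounded (f ` space M) \<longrightarrow>
        (\<lambda>N. \<integral>x. f x \<partial>Ms N) \<longlonglongrightarrow> (\<integral>x. f x \<partial>M))"

definition same_tilt_orbit ::
    "nat \<Rightarrow> (nat \<Rightarrow> real ^ 'k) \<Rightarrow> real ^ 'k \<Rightarrow> real ^ 'k \<Rightarrow> bool" where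
  "same_tilt_orbit r0 g \<mu> \<nu> \<longleftrightarrow>
     \<mu> \<in> pos_laws \<and> \<nu> \<in> pos_laws \<and>
     (\<exists>\<theta> :: nat \<Rightarrow> real. \<forall>x.
        \<nu> $ x = \<mu> $ x * exp (\<Sum>j=1..r0. \<theta> j * g j $ x) /
                (\<Sum>y\<in>UNIV. \<mu> $ y * exp (\<Sum>j=1..r0. \<theta> j * g j $ y)))"

definition tilt_orbit :: "nat \<Rightarrow> (nat \<Rightarrow> real ^ 'k) \<Rightarrow> real ^ 'k \<Rightarrow> (real ^ 'k) set" where
  "tilt_orbit r0 g \<mu> = {\<nu>. same_tilt_orbit r0 g \<mu> \<nu>}"

definition orbit_space :: "nat \<Rightarrow> (nat \<Rightarrow> real ^ 'k) \<Rightarrow> (real ^ 'k) set topology" where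
  "orbit_space r0 g =
     topology (\<lambda>U. U \<subseteq> tilt_orbit r0 g ` pos_laws \<and>
                   openin (top_of_set pos_laws) {\<mu> \<in> pos_laws. tilt_orbit r0 g \<mu> \<in> U})"

lemma openin_orbit_space:
  "openin (orbit_space r0 g) U \<longleftrightarrow>
     U \<subseteq> tilt_orbit r0 g ` pos_laws \<and>
     openin (top_of_set pos_laws) {\<mu> \<in> pos_laws. tilt_orbit r0 g \<mu> \<in> U}"
proof -
  let ?P = "\<lambda>U. U \<subseteq> tilt_orbit r0 g ` pos_laws \<and>
                 openin (top_of_set pos_laws) {\<mu> \<in> pos_laws. tilt_orbit r0 g \<mu> \<in> U}"
  have "istopology ?P"
    unfolding istopology_def
  proof (intro conjI allI impI)
    fix S T assume ST: "?P S" "?P T"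
    show "S \<inter> T \<subseteq> tilt_orbit r0 g ` pos_laws" using ST by blast
    have "{\<mu> \<in> pos_laws. tilt_orbit r0 g \<mu> \<in> S \<inter> T} =
          {\<mu> \<in> pos_laws. tilt_orbit r0 g \<mu> \<in> S} \<inter> {\<mu> \<in> pos_laws. tilt_orbit r0 g \<mu> \<in> T}"
      by blast
    with ST show "openin (top_of_set pos_laws) {\<mu> \<in> pos_laws. tilt_orbit r0 g \<mu> \<in> S \<inter> T}"
      by (simp only: openin_Int)
  next
    fix K assume K: "\<forall>S\<in>K. ?P S"
    show "\<Union>K \<subseteq> tilt_orbit r0 g ` pos_laws" using K by blast
    have "{\<mu> \<in> pos_laws. tilt_orbit r0 g \<mu> \<in> \<Union>K} =
          (\<Union>S\<in>K. {\<mu> \<in> pos_laws. tilt_orbit r0 g \<mu> \<in> S})"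
      by blast
    moreover have "openin (top_of_set pos_laws) (\<Union>S\<in>K. {\<mu> \<in> pos_laws. tilt_orbit r0 g \<mu> \<in> S})"
      using K by (intro openin_Union) blast
    ultimately show "openin (top_of_set pos_laws) {\<mu> \<in> pos_laws. tilt_orbit r0 g \<mu> \<in> \<Union>K}"
      by (simp only:)
  qed
  then show ?thesis
    by (simp add: orbit_space_def topology_inverse')
qed

lemma topspace_orbit_space: "topspace (orbit_space r0 g) = tilt_orbit r0 g ` pos_laws"
proof (rule antisym)
  show "topspace (orbit_space r0 g) \<subseteq> tilt_orbit r0 g ` pos_laws"
    using openin_topspace[of "orbit_space r0 g"] unfolding openin_orbit_space by (rule conjunct1)
  have "{\<mu> \<in> pos_laws. tilt_orbit r0 g \<mu> \<in> tilt_orbit r0 g ` pos_laws} = pos_laws" by blast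
  then have "openin (orbit_space r0 g) (tilt_orbit r0 g ` pos_laws)"
    unfolding openin_orbit_space by (simp only: order_refl openin_subtopology_self simp_thms)
  then show "tilt_orbit r0 g ` pos_laws \<subseteq> topspace (orbit_space r0 g)"
    by (rule openin_subset)
qed

lemma quotient_map_tilt_orbit:
  "quotient_map (top_of_set pos_laws) (orbit_space r0 g) (tilt_orbit r0 g)"
  unfolding quotient_map_def topspace_orbit_space
  by (simp add: openin_orbit_space)

definition orbit_borel :: "nat \<Rightarrow> (nat \<Rightarrow> real ^ 'k) \<Rightarrow> (real ^ 'k) set measure" where
  "orbit_borel r0 g = sigma (topspace (orbit_space r0 g)) {U. openin (orbit_space r0 g) U}"

text \<open>
  The law of the tilt orbit of a random law distributed as \<open>M\<close>. Orbits are only defined for strictly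
  positive laws; the definition is intended for \<open>M\<close> carried by these.
\<close>

definition orbit_law ::
    "nat \<Rightarrow> (nat \<Rightarrow> real ^ 'k) \<Rightarrow> (real ^ 'k) measure \<Rightarrow> (real ^ 'k) set measure" where
  "orbit_law r0 g M = distr (restrict_space M pos_laws) (orbit_borel r0 g) (tilt_orbit r0 g)"

definition manifold_of_dim :: "'a topology \<Rightarrow> nat \<Rightarrow> bool" where
  "manifold_of_dim X d \<longleftrightarrow>
     Hausdorff_space X \<and> second_countable X \<and>
     (\<forall>x\<in>topspace X. \<exists>U V. openin X U \<and> x \<in> U \<and> openin (Euclidean_space d) V \<and>
        subtopology X U homeomorphic_space subtopology (Euclidean_space d) V)"

text \<open>Here \<open>1\<close> is the constant function; \<open>independent\<close> speaks about sets, so repetitions are excluded separately.\<close>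

definition full_rank_mod_constants :: "nat \<Rightarrow> (nat \<Rightarrow> real ^ 'k) \<Rightarrow> bool" where
  "full_rank_mod_constants r0 g \<longleftrightarrow>
     inj_on g {1..r0} \<and> 1 \<notin> g ` {1..r0} \<and> independent (insert 1 (g ` {1..r0}))"

end

theory Submission
  imports Defs
begin

text \<open>
  Supports: outside the \<open>\<delta>\<close>-sublevel set of the rate on the compact set \<open>supp \<Pi>\<close>, the posterior density is
  exponentially small relative to the normalizing integral, which is at least of the order of
  \<open>exp (- N (I\<^sup>* + \<delta>/2))\<close>. Testing the weak convergence against the distance to the sublevel set kills the mass
  of the limit there.

  Projections: minimizers are unique because \<open>D(Q|\<mu>) + D(Q'|\<mu>)\<close> exceeds \<open>2 D(M|\<mu>)\<close> at the midpoint
  \<open>M\<close> by \<open>D(Q|M) + D(Q'|M)\<close>; compactness then makes the projection continuous on each face of the simplex.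
  For affine \<open>E\<close>, tilting \<open>\<mu>\<close> changes \<open>D(\<cdot>|\<mu>)\<close> on \<open>E\<close> only by a constant, so \<open>T\<close> is constant on orbits, and
  the first-order condition places an interior projection in the orbit of \<open>\<mu>\<close> itself.
\<close>

section \<open>Relative entropy and the I-projection\<close>

text \<open>Two different regularity demands shape the argument. Supports and orbits concern
  strictly positive laws, where the rate is finite and the projection continuous. The pushforward,
  however, is a \<open>distr\<close> of a map on the whole simplex, so measurability must also be
  settled at boundary laws, where the rate can be infinite, continuity is available only face by
  face, and \<open>I_proj\<close> may be an arbitrary choice. For affine \<open>E\<close> the two
  facts about orbits give maps in both directions: \<open>T\<close> factors through the orbit, and
  the orbit is recovered from the projection because the projection lies in it. This pair of maps,
  inverse to each other along the support, renders the claim that the randomness of the pushforward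
  is that of the orbit.\<close>

lemma prob_simplex_le_1: "p \<in> prob_simplex \<Longrightarrow> p $ x \<le> 1"
  unfolding prob_simplex_def
  by (metis (mono_tags, lifting) UNIV_I finite member_le_sum mem_Collect_eq)

lemma closed_prob_simplex: "closed (prob_simplex :: (real ^ 'k) set)"
proof -
  have "prob_simplex = (\<Inter>x. {p :: real ^ 'k. 0 \<le> p $ x}) \<inter> {p. (\<Sum>x\<in>UNIV. p $ x) = 1}"
    by (auto simp: prob_simplex_def)
  also have "closed \<dots>"
    by (intro closed_Int closed_INT ballI closed_Collect_le closed_Collect_eq continuous_intros)
  finally show ?thesis .
qed

lemma compact_prob_simplex: "compact (prob_simplex :: (real ^ 'k) set)"
proof -
  have "norm p \<le> real CARD('k)" if "p \<in> prob_simplex" for p :: "real ^ 'k"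
  proof -
    have "norm p \<le> (\<Sum>x\<in>UNIV. \<bar>p $ x\<bar>)" by (rule norm_le_l1_cart)
    also have "\<dots> \<le> (\<Sum>x\<in>(UNIV::'k set). 1)"
      by (rule sum_mono) (use that prob_simplex_le_1[OF that] in \<open>auto simp: prob_simplex_def\<close>)
    finally show ?thesis by simp
  qed
  then show ?thesis
    using closed_prob_simplex by (auto simp: compact_eq_bounded_closed intro: boundedI)
qed

lemma convex_prob_simplex: "convex (prob_simplex :: (real ^ 'k) set)"
proof (rule convexI)
  fix p q :: "real ^ 'k" and u v :: real
  assume *: "p \<in> prob_simplex" "q \<in> prob_simplex" "0 \<le> u" "0 \<le> v" "u + v = 1"
  then show "u *\<^sub>R p + v *\<^sub>R q \<in> prob_simplex"
    by (simp add: prob_simplex_def sum.distrib flip: sum_distrib_left)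
qed

lemma constraint_set_subset: "constraint_set r0 r g \<alpha> \<subseteq> prob_simplex"
  by (auto simp: constraint_set_def)

lemma constraint_set_eq:
  "constraint_set r0 r g \<alpha> =
     prob_simplex \<inter> (\<Inter>j\<in>{1..r0}. {Q. g j \<bullet> Q = \<alpha> j}) \<inter> (\<Inter>j\<in>{r0<..r}. {Q. g j \<bullet> Q \<ge> \<alpha> j})"
  by (auto simp: constraint_set_def)

lemma compact_constraint_set: "compact (constraint_set r0 r g \<alpha>)"
  unfolding constraint_set_eq
  by (intro compact_Int_closed compact_prob_simplex closed_INT ballI
      closed_Collect_le closed_Collect_eq continuous_intros)

lemma convex_constraint_set: "convex (constraint_set r0 r g \<alpha>)"
  unfolding constraint_set_eq
  by (intro convex_Int convex_prob_simplex convex_INT ballI convex_hyperplane convex_halfspace_ge)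

section \<open>Gibbs' inequality and the midpoint identity\<close>

definition entropy_sum :: "real ^ 'k \<Rightarrow> real ^ 'k \<Rightarrow> real" where
  "entropy_sum Q \<mu> = (\<Sum>x\<in>UNIV. Q $ x * ln (Q $ x / \<mu> $ x))"

definition abs_cont :: "real ^ 'k \<Rightarrow> real ^ 'k \<Rightarrow> bool" where
  "abs_cont Q \<mu> \<longleftrightarrow> (\<forall>x. \<mu> $ x = 0 \<longrightarrow> Q $ x = 0)"

lemma rel_entropy_eq: "rel_entropy Q \<mu> = (if abs_cont Q \<mu> then ereal (entropy_sum Q \<mu>) else \<infinity>)"
  by (simp add: rel_entropy_def abs_cont_def entropy_sum_def)

text \<open>This is \<open>ln t \<le> t - 1\<close> at \<open>t = m / q\<close>, with equality only
  at \<open>t = 1\<close>. When \<open>m = 0\<close>, the hypothesis makes \<open>q\<close> vanish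
  as well and both sides are 0.\<close>

lemma mult_ln_div_ge:
  fixes q m :: real
  assumes "0 \<le> q" "0 \<le> m" "m = 0 \<longrightarrow> q = 0"
  shows "q - m \<le> q * ln (q / m)" and "q * ln (q / m) = q - m \<Longrightarrow> q = m"
proof -
  have *: "q * ln (q / m) = - (q * ln (m / q))" if "0 < q" "0 < m"
    using that by (simp add: ln_div algebra_simps)
  show "q - m \<le> q * ln (q / m)"
  proof (cases "q = 0 \<or> m = 0")
    case False
    then have qm: "0 < q" "0 < m" using assms by auto
    have "q * ln (m / q) \<le> q * (m / q - 1)"
      using qm by (intro mult_left_mono ln_le_minus_one) auto
    also have "\<dots> = m - q" using qm by (simp add: field_simps)
    finally show ?thesis using *[OF qm] by simp
  qed (use assms in auto)
  assume eq: "q * ln (q / m) = q - m"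
  show "q = m"
  proof (cases "q = 0 \<or> m = 0")
    case False
    then have qm: "0 < q" "0 < m" using assms by auto
    have "q * (m / q - 1) = m - q" using qm by (simp add: field_simps)
    then have "q * ln (m / q) = q * (m / q - 1)" using eq *[OF qm] by linarith
    then have "ln (m / q) = m / q - 1" using qm by simp
    then have "m / q = 1" using qm by (intro ln_eq_minus_one) auto
    then show ?thesis using qm by simp
  qed (use assms eq in auto)
qed

text \<open>The lower bounds \<open>Q $ x - \<mu> $ x\<close> have total 0, so summing the scalar
  inequality gives nonnegativity. If the sum is 0, every nonnegative gap is 0 and the equality case
  applies coordinatewise.\<close>

lemma
  assumes "Q \<in> prob_simplex" "\<mu> \<in> prob_simplex" "abs_cont Q \<mu>"
  shows entropy_sum_nonneg: "0 \<le> entropy_sum Q \<mu>"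
    and entropy_sum_eq_0D: "entropy_sum Q \<mu> = 0 \<Longrightarrow> Q = \<mu>"
proof -
  have ge: "Q $ x - \<mu> $ x \<le> Q $ x * ln (Q $ x / \<mu> $ x)" for x
    using assms by (intro mult_ln_div_ge) (auto simp: prob_simplex_def abs_cont_def)
  have sum0: "(\<Sum>x\<in>UNIV. Q $ x - \<mu> $ x) = 0"
    using assms by (simp add: prob_simplex_def sum_subtractf)
  show "0 \<le> entropy_sum Q \<mu>"
    using sum_mono[of UNIV "\<lambda>x. Q $ x - \<mu> $ x", OF ge] sum0 by (simp add: entropy_sum_def)
  assume "entropy_sum Q \<mu> = 0"
  then have "(\<Sum>x\<in>UNIV. Q $ x * ln (Q $ x / \<mu> $ x) - (Q $ x - \<mu> $ x)) = 0"
    using sum0 by (simp add: entropy_sum_def sum_subtractf)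
  then have "Q $ x * ln (Q $ x / \<mu> $ x) - (Q $ x - \<mu> $ x) = 0" for x
    using ge by (subst (asm) sum_nonneg_eq_0_iff) auto
  then have "Q $ x * ln (Q $ x / \<mu> $ x) = Q $ x - \<mu> $ x" for x
    by (simp add: algebra_simps)
  then have "Q $ x = \<mu> $ x" for x
    by (rule mult_ln_div_ge(2)[rotated -1]) (use assms in \<open>auto simp: prob_simplex_def abs_cont_def\<close>)
  then show "Q = \<mu>" by (simp add: vec_eq_iff)
qed

lemma entropy_sum_self: "entropy_sum \<mu> \<mu> = 0"
  unfolding entropy_sum_def by (rule sum.neutral) (metis div_self division_ring_divide_zero ln_one mult_zero_left mult_zero_right UNIV_I)

text \<open>Each logarithm is split by passing through the midpoint, and the terms
  \<open>ln (M / m)\<close> collect because \<open>q + q' = 2 * M\<close>. Absolute continuity keeps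
  all five quantities finite, so this is an identity of real numbers.\<close>

lemma entropy_sum_midpoint:
  assumes "Q \<in> prob_simplex" "Q' \<in> prob_simplex" "\<mu> \<in> prob_simplex" "abs_cont Q \<mu>" "abs_cont Q' \<mu>"
  defines "M \<equiv> (1/2) *\<^sub>R Q + (1/2) *\<^sub>R Q'"
  shows "entropy_sum Q \<mu> + entropy_sum Q' \<mu> =
    2 * entropy_sum M \<mu> + entropy_sum Q M + entropy_sum Q' M"
proof -
  have scalar: "q * ln (q / m) + q' * ln (q' / m) =
      2 * (M * ln (M / m)) + q * ln (q / M) + q' * ln (q' / M)"
    if "0 \<le> q" "0 \<le> q'" "0 \<le> m" "m = 0 \<longrightarrow> q = 0 \<and> q' = 0" "M = (q + q') / 2" for q q' m M :: real
  proof (cases "m = 0")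
    case False
    \<comment> \<open>At \<open>t = 0\<close> both sides vanish, so positivity of \<open>M\<close>
      is asked only where \<open>t\<close> is positive.\<close>
    have split: "t * ln (t / m) = t * ln (M / m) + t * ln (t / M)" if "0 \<le> t" "t > 0 \<longrightarrow> 0 < M" for t
      using that False \<open>0 \<le> m\<close> by (cases "t = 0") (auto simp: ln_div algebra_simps)
    have "q * ln (q / m) = q * ln (M / m) + q * ln (q / M)"
         "q' * ln (q' / m) = q' * ln (M / m) + q' * ln (q' / M)"
      using that by (auto intro!: split)
    moreover have "2 * (M * ln (M / m)) = q * ln (M / m) + q' * ln (M / m)"
      using that(5) by (simp flip: distrib_right)
    ultimately show ?thesis by simp
  qed (use that in auto)
  have "Q $ x * ln (Q $ x / \<mu> $ x) + Q' $ x * ln (Q' $ x / \<mu> $ x) =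
      2 * (M $ x * ln (M $ x / \<mu> $ x)) + Q $ x * ln (Q $ x / M $ x) + Q' $ x * ln (Q' $ x / M $ x)" for x
    using assms by (intro scalar) (auto simp: prob_simplex_def abs_cont_def M_def field_simps)
  then show ?thesis
    unfolding entropy_sum_def sum_distrib_left sum.distrib[symmetric] by (simp add: add.assoc)
qed

text \<open>
  The simplex is cut into finitely many pieces according to the support \<open>S\<close> of the law: on each of
  them the relative entropy is either a continuous function on a face of \<open>E\<close> or constantly infinite.
\<close>

definition laws_on :: "'k set \<Rightarrow> (real ^ 'k) set" where
  "laws_on S = {\<mu> \<in> prob_simplex. \<forall>x. 0 < \<mu> $ x \<longleftrightarrow> x \<in> S}"

definition face :: "(real ^ 'k) set \<Rightarrow> 'k set \<Rightarrow> (real ^ 'k) set" where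
  "face E S = {Q \<in> E. \<forall>x. x \<notin> S \<longrightarrow> Q $ x = 0}"

lemma pos_laws_eq_laws_on: "pos_laws = laws_on UNIV"
  by (auto simp: pos_laws_def laws_on_def)

lemma face_UNIV: "face E UNIV = E"
  by (auto simp: face_def)

lemma laws_on_eq_0: "\<mu> \<in> laws_on S \<Longrightarrow> \<mu> $ x = 0 \<longleftrightarrow> x \<notin> S"
  by (force simp: laws_on_def prob_simplex_def order_less_le)

lemma abs_cont_laws_on: "\<mu> \<in> laws_on S \<Longrightarrow> Q \<in> E \<Longrightarrow> abs_cont Q \<mu> \<longleftrightarrow> Q \<in> face E S"
  by (auto simp: abs_cont_def face_def laws_on_eq_0)

lemma ex_laws_on: "\<mu> \<in> prob_simplex \<Longrightarrow> \<mu> \<in> laws_on {x. 0 < \<mu> $ x}"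
  by (auto simp: laws_on_def)

lemma compact_face: assumes "compact E" shows "compact (face E S)"
proof -
  have "face E S = E \<inter> (\<Inter>x\<in>-S. {Q. Q $ x = 0})" by (auto simp: face_def)
  also have "compact \<dots>"
    by (intro compact_Int_closed assms closed_INT ballI closed_Collect_eq continuous_intros)
  finally show ?thesis .
qed

text \<open>The value at 0 is 0 by \<open>0 * ln 0 = 0\<close>, which is also the limit from the
  right. This covers laws \<open>Q\<close> on the boundary of a face.\<close>

lemma continuous_on_mult_ln: "continuous_on {0..} (\<lambda>t::real. t * ln t)"
proof (rule continuous_on_eq_continuous_within[THEN iffD2], rule ballI)
  fix t :: real assume "t \<in> {0..}"
  show "continuous (at t within {0..}) (\<lambda>t. t * ln t)"
  proof (cases "t = 0")
    case True
    have "((\<lambda>t::real. t * ln t) \<longlongrightarrow> 0) (at_right 0)"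
      by real_asymp
    then show ?thesis
      using True by (simp add: continuous_within at_within_Ici_at_right)
  next
    case False
    with \<open>t \<in> {0..}\<close> show ?thesis by (intro continuous_intros) auto
  qed
qed

text \<open>Writing \<open>ln (q / m)\<close> as a difference separates the two boundary problems:
  \<open>q * ln q\<close> is continuous up to 0, and \<open>ln m\<close> is evaluated either at a
  positive coordinate or where \<open>q\<close> vanishes.\<close>

lemma continuous_on_entropy_sum:
  assumes "E \<subseteq> prob_simplex"
  shows "continuous_on (laws_on S \<times> face E S) (\<lambda>(\<mu>, Q). entropy_sum Q \<mu>)"
proof -
  have eq: "entropy_sum Q \<mu> = (\<Sum>x\<in>UNIV. Q $ x * ln (Q $ x) - Q $ x * ln (\<mu> $ x))"
    if "\<mu> \<in> laws_on S" "Q \<in> face E S" for \<mu> Q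
    unfolding entropy_sum_def
  proof (rule sum.cong[OF refl])
    fix x
    have "0 \<le> Q $ x" using that assms by (auto simp: face_def prob_simplex_def)
    moreover have "0 \<le> \<mu> $ x" "\<mu> $ x = 0 \<longrightarrow> Q $ x = 0"
      using that laws_on_eq_0[of \<mu> S x] by (auto simp: face_def laws_on_def prob_simplex_def)
    ultimately show "Q $ x * ln (Q $ x / \<mu> $ x) = Q $ x * ln (Q $ x) - Q $ x * ln (\<mu> $ x)"
      by (cases "Q $ x = 0") (auto simp: ln_div algebra_simps)
  qed
  \<comment> \<open>Off \<open>S\<close> the coordinate of the reference law is 0, and
    \<open>ln 0 = 0\<close> makes the function constant there.\<close>
  have ln_cont: "continuous_on (laws_on S \<times> face E S) (\<lambda>z. ln (fst z $ x))" for x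
  proof (cases "x \<in> S")
    case True
    then have "\<forall>z\<in>laws_on S \<times> face E S. fst z $ x \<noteq> 0" by (auto simp: laws_on_eq_0)
    then show ?thesis by (intro continuous_on_ln continuous_intros) auto
  next
    case False
    then have "ln (fst z $ x) = 0" if "z \<in> laws_on S \<times> face E S" for z
      using that by (auto simp: mem_Times_iff laws_on_eq_0[THEN iffD2])
    then show ?thesis
      by (intro continuous_on_eq[OF continuous_on_const[of _ 0]]) simp
  qed
  have A: "continuous_on (laws_on S \<times> face E S) (\<lambda>z. snd z $ x * ln (snd z $ x))" for x
    by (rule continuous_on_compose2[OF continuous_on_mult_ln])
      (use assms in \<open>auto simp: face_def prob_simplex_def intro!: continuous_intros\<close>)
  have B: "continuous_on (laws_on S \<times> face E S) (\<lambda>z. snd z $ x * ln (fst z $ x))" for x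
    by (intro continuous_on_mult ln_cont) (intro continuous_intros)
  have "continuous_on (laws_on S \<times> face E S)
      (\<lambda>z. \<Sum>x\<in>UNIV. snd z $ x * ln (snd z $ x) - snd z $ x * ln (fst z $ x))"
    by (intro continuous_on_sum continuous_on_diff A B)
  then show ?thesis
    by (rule continuous_on_eq) (auto simp: eq)
qed

lemma rel_entropy_laws_on:
  "\<mu> \<in> laws_on S \<Longrightarrow> Q \<in> E \<Longrightarrow>
     rel_entropy Q \<mu> = (if Q \<in> face E S then ereal (entropy_sum Q \<mu>) else \<infinity>)"
  by (simp add: rel_entropy_eq abs_cont_laws_on)

section \<open>Existence, uniqueness and continuity of the I-projection\<close>

text \<open>A point of the face has finite entropy and so beats every point of \<open>E\<close>
  outside it. The extended-real problem on \<open>E\<close> thus becomes a real-valued one on the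
  face.\<close>

lemma is_arg_min_rel_entropy_iff:
  assumes "\<mu> \<in> laws_on S" "face E S \<noteq> {}"
  shows "is_arg_min (\<lambda>Q. rel_entropy Q \<mu>) (\<lambda>Q. Q \<in> E) P \<longleftrightarrow>
     P \<in> face E S \<and> (\<forall>Q\<in>face E S. entropy_sum P \<mu> \<le> entropy_sum Q \<mu>)"
proof -
  obtain Q0 where Q0: "Q0 \<in> face E S" "Q0 \<in> E" using assms by (auto simp: face_def)
  show ?thesis
    unfolding is_arg_min_linorder
    using assms(1) Q0 by (auto simp: rel_entropy_laws_on split: if_splits simp: face_def)
qed

lemma entropy_sum_min_unique:
  assumes "convex E" "E \<subseteq> prob_simplex" "\<mu> \<in> laws_on S"
    and P: "P \<in> face E S" "\<forall>Q\<in>face E S. entropy_sum P \<mu> \<le> entropy_sum Q \<mu>"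
    and P': "P' \<in> face E S" "\<forall>Q\<in>face E S. entropy_sum P' \<mu> \<le> entropy_sum Q \<mu>"
  shows "P = P'"
proof -
  define M where "M = (1/2) *\<^sub>R P + (1/2) *\<^sub>R P'"
  have E: "P \<in> E" "P' \<in> E" using P P' by (auto simp: face_def)
  then have "M \<in> E" unfolding M_def by (intro convexD[OF assms(1)]) auto
  then have MF: "M \<in> face E S" using P P' by (auto simp: face_def M_def)
  have laws: "P \<in> prob_simplex" "P' \<in> prob_simplex" "M \<in> prob_simplex" "\<mu> \<in> prob_simplex"
    using E \<open>M \<in> E\<close> assms by (auto simp: laws_on_def)
  have ac: "abs_cont P \<mu>" "abs_cont P' \<mu>" using assms(3) E P P' by (auto simp: abs_cont_laws_on)
  \<comment> \<open>The midpoint vanishes only where both endpoints do, so it dominates both of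
    them.\<close>
  have acM: "abs_cont P M" "abs_cont P' M"
    using laws by (auto simp: abs_cont_def M_def prob_simplex_def add_nonneg_eq_0_iff)
  have "entropy_sum P \<mu> + entropy_sum P' \<mu> =
      2 * entropy_sum M \<mu> + entropy_sum P M + entropy_sum P' M"
    unfolding M_def using laws ac by (intro entropy_sum_midpoint)
  moreover have "entropy_sum P \<mu> \<le> entropy_sum M \<mu>" "entropy_sum P' \<mu> \<le> entropy_sum M \<mu>"
    using P P' MF by auto
  moreover have "0 \<le> entropy_sum P M" "0 \<le> entropy_sum P' M"
    using laws acM by (auto intro: entropy_sum_nonneg)
  ultimately have "entropy_sum P M = 0" "entropy_sum P' M = 0" by linarith+
  then show ?thesis using laws acM entropy_sum_eq_0D by metis
qed

lemma
  assumes "compact E" "convex E" "E \<subseteq> prob_simplex" "\<mu> \<in> laws_on S" "face E S \<noteq> {}"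
  shows I_proj_in_face: "I_proj E \<mu> \<in> face E S"
    and I_proj_minimal: "Q \<in> face E S \<Longrightarrow> entropy_sum (I_proj E \<mu>) \<mu> \<le> entropy_sum Q \<mu>"
    and I_proj_eqI: "\<lbrakk>P \<in> face E S; \<And>Q. Q \<in> face E S \<Longrightarrow> entropy_sum P \<mu> \<le> entropy_sum Q \<mu>\<rbrakk>
          \<Longrightarrow> I_proj E \<mu> = P"
    and rate_eq_entropy_sum: "rate E \<mu> = ereal (entropy_sum (I_proj E \<mu>) \<mu>)"
proof -
  have "continuous_on (face E S) ((\<lambda>(\<mu>, Q). entropy_sum Q \<mu>) \<circ> Pair \<mu>)"
    using assms by (intro continuous_on_compose continuous_on_subset[OF continuous_on_entropy_sum]
        continuous_intros) auto
  then have "continuous_on (face E S) (\<lambda>Q. entropy_sum Q \<mu>)" by (simp add: comp_def)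
  then obtain P0 where P0: "P0 \<in> face E S" "\<forall>Q\<in>face E S. entropy_sum P0 \<mu> \<le> entropy_sum Q \<mu>"
    using continuous_attains_inf[OF compact_face[OF assms(1)] assms(5)] by blast
  then have "is_arg_min (\<lambda>Q. rel_entropy Q \<mu>) (\<lambda>Q. Q \<in> E) P0"
    by (simp add: is_arg_min_rel_entropy_iff[OF assms(4,5)])
  then have "is_arg_min (\<lambda>Q. rel_entropy Q \<mu>) (\<lambda>Q. Q \<in> E) (I_proj E \<mu>)"
    unfolding I_proj_def arg_min_on_def arg_min_def by (rule someI)
  then have *: "I_proj E \<mu> \<in> face E S" "\<forall>Q\<in>face E S. entropy_sum (I_proj E \<mu>) \<mu> \<le> entropy_sum Q \<mu>"
    by (simp_all add: is_arg_min_rel_entropy_iff[OF assms(4,5)])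
  show "I_proj E \<mu> \<in> face E S" by fact
  show "Q \<in> face E S \<Longrightarrow> entropy_sum (I_proj E \<mu>) \<mu> \<le> entropy_sum Q \<mu>" using * by blast
  show "I_proj E \<mu> = P"
    if "P \<in> face E S" "\<And>Q. Q \<in> face E S \<Longrightarrow> entropy_sum P \<mu> \<le> entropy_sum Q \<mu>"
    using entropy_sum_min_unique[OF assms(2-4) *] that by blast
  show "rate E \<mu> = ereal (entropy_sum (I_proj E \<mu>) \<mu>)"
    unfolding rate_def
  proof (rule antisym)
    show "(INF Q\<in>E. rel_entropy Q \<mu>) \<le> ereal (entropy_sum (I_proj E \<mu>) \<mu>)"
      using * assms(4) by (intro INF_lower2[of "I_proj E \<mu>"]) (auto simp: rel_entropy_laws_on face_def)
    show "ereal (entropy_sum (I_proj E \<mu>) \<mu>) \<le> (INF Q\<in>E. rel_entropy Q \<mu>)"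
      using * assms(4) by (intro INF_greatest) (auto simp: rel_entropy_laws_on)
  qed
qed

text \<open>All values on \<open>E\<close> are infinite, so the predicate defining a minimizer is
  membership in \<open>E\<close>, whatever \<mu> is. Hilbert choice applied to equal predicates
  returns one fixed point, which makes the projection constant on such a piece.\<close>

lemma
  assumes "\<mu> \<in> laws_on S" "face E S = {}"
  shows I_proj_no_face: "I_proj E \<mu> = (SOME Q. Q \<in> E)"
    and rate_no_face: "rate E \<mu> = \<infinity>"
proof -
  have inf: "rel_entropy Q \<mu> = \<infinity>" if "Q \<in> E" for Q
    using assms that by (simp add: rel_entropy_laws_on)
  then have "is_arg_min (\<lambda>Q. rel_entropy Q \<mu>) (\<lambda>Q. Q \<in> E) = (\<lambda>Q. Q \<in> E)"
    by (auto simp: is_arg_min_def fun_eq_iff)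
  then show "I_proj E \<mu> = (SOME Q. Q \<in> E)"
    by (simp add: I_proj_def arg_min_on_def arg_min_def)
  show "rate E \<mu> = \<infinity>"
    unfolding rate_def using inf by (simp add: top_ereal_def[symmetric])
qed

text \<open>A closed graph in a product with a compact face forces continuity. The graph consists of
  the pairs at which \<open>P\<close> is no worse than each competitor \<open>Q\<close>, an
  intersection of relatively closed conditions; uniqueness of the minimizer makes this set a
  graph.\<close>

lemma continuous_on_I_proj:
  assumes E: "compact E" "convex E" "E \<subseteq> prob_simplex" and ne: "face E S \<noteq> {}"
  shows "continuous_on (laws_on S) (I_proj E)"
proof -
  have maps: "I_proj E \<in> laws_on S \<rightarrow> face E S"
    using I_proj_in_face[OF E _ ne] by blast
  let ?L = "laws_on S \<times> face E S"
  have "(\<lambda>\<mu>. Pair \<mu> (I_proj E \<mu>)) ` laws_on S =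
      (\<Inter>Q\<in>face E S. {z \<in> ?L. entropy_sum (snd z) (fst z) \<le> entropy_sum Q (fst z)})" (is "?G = ?C")
  proof (intro equalityI subsetI)
    fix z assume "z \<in> ?G"
    then show "z \<in> ?C" using I_proj_in_face[OF E _ ne] I_proj_minimal[OF E _ ne] by auto
  next
    fix z assume z: "z \<in> ?C"
    obtain \<mu> P where [simp]: "z = (\<mu>, P)" by fastforce
    have "\<mu> \<in> laws_on S" "P \<in> face E S" "\<And>Q. Q \<in> face E S \<Longrightarrow> entropy_sum P \<mu> \<le> entropy_sum Q \<mu>"
      using z ne by auto
    then show "z \<in> ?G" using I_proj_eqI[OF E _ ne] by force
  qed
  moreover have "closedin (top_of_set ?L)
      {z \<in> ?L. entropy_sum (snd z) (fst z) \<le> entropy_sum Q (fst z)}" if Q: "Q \<in> face E S" for Q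
  proof -
    have c1: "continuous_on ?L (\<lambda>z. entropy_sum (snd z) (fst z))"
      using continuous_on_entropy_sum[OF E(3), of S] by (simp add: case_prod_unfold)
    have "continuous_on ?L (\<lambda>z. (\<lambda>z. entropy_sum (snd z) (fst z)) (fst z, Q))"
      by (rule continuous_on_compose2[OF c1]) (use Q in \<open>auto intro!: continuous_intros\<close>)
    then have "continuous_on ?L (\<lambda>z. entropy_sum (snd z) (fst z) - entropy_sum Q (fst z))"
      using c1 by (intro continuous_intros) auto
    then have "closedin (top_of_set ?L)
       (?L \<inter> (\<lambda>z. entropy_sum (snd z) (fst z) - entropy_sum Q (fst z)) -` {..0})"
      by (rule continuous_closedin_preimage) simp
    also have "?L \<inter> (\<lambda>z. entropy_sum (snd z) (fst z) - entropy_sum Q (fst z)) -` {..0} =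
       {z \<in> ?L. entropy_sum (snd z) (fst z) \<le> entropy_sum Q (fst z)}" by auto
    finally show ?thesis .
  qed
  ultimately have "closedin (top_of_set ?L) ?G"
    using ne by (auto intro!: closedin_Inter)
  then show ?thesis
    by (rule continuous_closed_graph_eq[OF compact_face[OF E(1)] maps, THEN iffD2])
qed

lemma I_proj_in:
  assumes E: "compact E" "convex E" "E \<subseteq> prob_simplex" "E \<noteq> {}" and "\<mu> \<in> prob_simplex"
  shows "I_proj E \<mu> \<in> E"
proof -
  obtain S where S: "\<mu> \<in> laws_on S" using ex_laws_on[OF assms(5)] by blast
  show ?thesis
  proof (cases "face E S = {}")
    case True
    then show ?thesis using I_proj_no_face[OF S True] E(4) by (simp add: some_in_eq)
  next
    case False
    then show ?thesis using I_proj_in_face[OF E(1-3) S False] by (simp add: face_def)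
  qed
qed

lemma I_proj_self:
  assumes E: "compact E" "convex E" "E \<subseteq> prob_simplex" and "\<mu> \<in> E"
  shows "I_proj E \<mu> = \<mu>" "rate E \<mu> = 0"
proof -
  have "\<mu> \<in> prob_simplex" using assms by auto
  then obtain S where S: "\<mu> \<in> laws_on S" using ex_laws_on by blast
  then have F: "\<mu> \<in> face E S" using \<open>\<mu> \<in> E\<close> by (auto simp: face_def laws_on_eq_0)
  show T: "I_proj E \<mu> = \<mu>"
  proof (rule I_proj_eqI[OF E S _ F])
    fix Q assume "Q \<in> face E S"
    then show "entropy_sum \<mu> \<mu> \<le> entropy_sum Q \<mu>"
      using E S \<open>\<mu> \<in> prob_simplex\<close> abs_cont_laws_on[OF S, of Q E]
      by (auto simp: entropy_sum_self face_def intro!: entropy_sum_nonneg)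
  qed (use F in auto)
  show "rate E \<mu> = 0"
    using rate_eq_entropy_sum[OF E S] F T by (auto simp: entropy_sum_self zero_ereal_def)
qed

text \<open>Attainment is decisive: a rate of 0 is finite, hence realized by the projection, and the
  equality case of Gibbs' inequality identifies the projection with \<mu>.\<close>

lemma rate_eq_0_iff:
  assumes E: "compact E" "convex E" "E \<subseteq> prob_simplex" and "\<mu> \<in> prob_simplex"
  shows "rate E \<mu> = 0 \<longleftrightarrow> \<mu> \<in> E"
proof
  assume 0: "rate E \<mu> = 0"
  obtain S where S: "\<mu> \<in> laws_on S" using ex_laws_on[OF assms(4)] by blast
  have ne: "face E S \<noteq> {}" using rate_no_face[OF S] 0 by auto
  have P: "I_proj E \<mu> \<in> face E S" by (rule I_proj_in_face[OF E S ne])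
  then have PE: "I_proj E \<mu> \<in> E" by (simp add: face_def)
  have "entropy_sum (I_proj E \<mu>) \<mu> = 0"
    using rate_eq_entropy_sum[OF E S ne] 0 by (simp add: zero_ereal_def)
  then have "I_proj E \<mu> = \<mu>"
    using PE P E(3) assms(4) abs_cont_laws_on[OF S PE] by (intro entropy_sum_eq_0D) auto
  then show "\<mu> \<in> E" using PE by simp
qed (rule I_proj_self[OF E])

lemma rate_pos_laws:
  assumes E: "compact E" "convex E" "E \<subseteq> prob_simplex" "E \<noteq> {}" and "\<mu> \<in> pos_laws"
  shows "rate E \<mu> = ereal (entropy_sum (I_proj E \<mu>) \<mu>)"
  using assms rate_eq_entropy_sum[OF E(1-3), of \<mu> UNIV] by (simp add: pos_laws_eq_laws_on face_UNIV)

lemma continuous_on_I_proj_pos_laws: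
  assumes E: "compact E" "convex E" "E \<subseteq> prob_simplex" "E \<noteq> {}"
  shows "continuous_on pos_laws (I_proj E)"
  using continuous_on_I_proj[OF E(1-3), of UNIV] E(4) by (simp add: pos_laws_eq_laws_on face_UNIV)

lemma continuous_on_rate:
  assumes E: "compact E" "convex E" "E \<subseteq> prob_simplex" "E \<noteq> {}"
  shows "continuous_on pos_laws (\<lambda>\<mu>. entropy_sum (I_proj E \<mu>) \<mu>)"
proof -
  have c: "continuous_on (pos_laws \<times> E) (\<lambda>z. entropy_sum (snd z) (fst z))"
    using continuous_on_entropy_sum[OF E(3), of UNIV]
    by (simp add: case_prod_unfold pos_laws_eq_laws_on face_UNIV)
  have "continuous_on pos_laws (\<lambda>\<mu>. (\<lambda>z. entropy_sum (snd z) (fst z)) (\<mu>, I_proj E \<mu>))"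
    by (rule continuous_on_compose2[OF c])
      (use I_proj_in[OF E] in \<open>auto simp: pos_laws_def intro!: continuous_intros
        continuous_on_I_proj_pos_laws[OF E, unfolded pos_laws_def]\<close>)
  then show ?thesis by simp
qed

section \<open>Borel measurability of the I-projection\<close>

lemma prob_simplex_borel: "prob_simplex \<in> sets borel"
  by (intro borel_closed closed_prob_simplex)

lemma pos_laws_borel: "pos_laws \<in> sets borel"
proof -
  have "pos_laws = prob_simplex \<inter> (\<Inter>x. {p. 0 < p $ x})" by (auto simp: pos_laws_def)
  also have "\<dots> \<in> sets borel"
    by (intro sets.Int prob_simplex_borel borel_open open_INT ballI open_Collect_less continuous_intros) auto
  finally show ?thesis .
qed

lemma space_simplex_borel [simp]: "space simplex_borel = prob_simplex"
  by (simp add: space_restrict_space)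

lemma laws_on_borel: "laws_on S \<in> sets borel"
proof -
  have "laws_on S = prob_simplex \<inter> (\<Inter>x\<in>S. {p. 0 < p $ x}) \<inter> (\<Inter>x\<in>-S. {p. p $ x \<le> 0})"
    unfolding laws_on_def not_less[symmetric] by blast
  also have "\<dots> \<in> sets borel"
    by (intro sets.Int prob_simplex_borel borel_open borel_closed open_INT closed_INT ballI
        open_Collect_less closed_Collect_le continuous_intros) auto
  finally show ?thesis .
qed

text \<open>The finitely many sets \<open>laws_on S\<close> are Borel and cover the simplex. On
  each, the projection is continuous or, when no point of \<open>E\<close> is dominated,
  constant.\<close>

lemma I_proj_measurable:
  assumes E: "compact E" "convex E" "E \<subseteq> prob_simplex" "E \<noteq> {}"
  shows "I_proj (E :: (real ^ 'k) set) \<in> measurable simplex_borel simplex_borel"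
proof -
  have "I_proj E \<in> measurable simplex_borel borel"
  proof (rule measurable_piecewise_restrict[where C = "range (laws_on :: 'k set \<Rightarrow> _)"])
    show "countable (range (laws_on :: 'k set \<Rightarrow> _))" by (simp add: countable_finite)
    show "\<Omega> \<inter> space simplex_borel \<in> sets simplex_borel" if "\<Omega> \<in> range laws_on" for \<Omega> :: "(real ^ 'k) set"
    proof -
      have "\<Omega> \<in> sets borel" using that laws_on_borel by blast
      then show ?thesis by (auto simp: sets_restrict_space)
    qed
    have "\<mu> \<in> \<Union>(range laws_on)" if "\<mu> \<in> prob_simplex" for \<mu> :: "real ^ 'k"
      using ex_laws_on[OF that] by blast
    then show "space simplex_borel \<subseteq> \<Union>(range (laws_on :: 'k set \<Rightarrow> _))" by auto
    fix \<Omega> :: "(real ^ 'k) set" assume "\<Omega> \<in> range laws_on"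
    then obtain S where \<Omega>: "\<Omega> = laws_on S" by auto
    have cont: "continuous_on (laws_on S) (I_proj E)"
    proof (cases "face E S = {}")
      case True
      then show ?thesis
        by (intro continuous_on_eq[OF continuous_on_const[of _ "SOME Q. Q \<in> E"]])
          (simp add: I_proj_no_face)
    next
      case False
      then show ?thesis by (rule continuous_on_I_proj[OF E(1-3)])
    qed
    then have "I_proj E \<in> measurable (restrict_space borel (laws_on S)) borel"
      by (rule borel_measurable_continuous_on_restrict)
    also have "(restrict_space borel (laws_on S) :: (real ^ 'k) measure) = restrict_space simplex_borel \<Omega>"
    proof -
      have "prob_simplex \<inter> laws_on S = laws_on S" by (auto simp: laws_on_def)
      then show ?thesis
        by (simp add: restrict_restrict_space \<Omega> laws_on_borel prob_simplex_borel)
    qed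
    finally show "I_proj E \<in> measurable (restrict_space simplex_borel \<Omega>) borel" .
  qed
  then show ?thesis
    using I_proj_in[OF E] E(3) by (intro measurable_restrict_space2) auto
qed

section \<open>Concentration of the constraint posterior\<close>

lemma prob_space_law_measure:
  assumes "\<mu> \<in> prob_simplex"
  shows "prob_space (law_measure \<mu>)"
proof
  have "emeasure (law_measure \<mu>) UNIV = ennreal (\<Sum>x\<in>UNIV. \<mu> $ x)"
    using assms unfolding law_measure_def prob_simplex_def
    by (subst emeasure_point_measure_finite) auto
  then show "emeasure (law_measure \<mu>) (space (law_measure \<mu>)) = 1"
    using assms by (simp add: law_measure_def space_point_measure prob_simplex_def)
qed

lemma prob_empirical_in_nonneg: "0 \<le> prob_empirical_in N A \<mu>"
  by (simp add: prob_empirical_in_def)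

lemma prob_empirical_in_le_1:
  assumes "\<mu> \<in> prob_simplex"
  shows "prob_empirical_in N A \<mu> \<le> 1"
  unfolding prob_empirical_in_def sample_measure_def
  by (intro prob_space.prob_le_1 prob_space_PiM prob_space_law_measure assms)

text \<open>Only finitely many samples exist, so the probability is a polynomial in the coordinates
  of \<mu>; its measurability in \<mu> is read off from this form.\<close>

lemma prob_empirical_in_eq:
  assumes "\<mu> \<in> prob_simplex"
  shows "prob_empirical_in N A \<mu> =
    (\<Sum>\<omega>\<in>{\<omega> \<in> {1..N} \<rightarrow>\<^sub>E UNIV. empirical N \<omega> \<in> A}. \<Prod>i=1..N. \<mu> $ \<omega> i)"
proof -
  have nn: "0 \<le> \<mu> $ x" for x using assms by (simp add: prob_simplex_def)
  have single: "emeasure (law_measure \<mu>) {x} = ennreal (\<mu> $ x)" for x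
    unfolding law_measure_def by (subst emeasure_point_measure_finite) auto
  interpret L: prob_space "law_measure \<mu>" by (rule prob_space_law_measure[OF assms])
  interpret P: product_prob_space "\<lambda>_::nat. law_measure \<mu>" "{1..N}" ..
  have sp: "space (sample_measure N \<mu>) = {1..N} \<rightarrow>\<^sub>E UNIV"
    by (simp add: sample_measure_def space_PiM law_measure_def space_point_measure)
  have em: "emeasure (sample_measure N \<mu>) {\<omega>} = ennreal (\<Prod>i=1..N. \<mu> $ \<omega> i)"
    and se: "{\<omega>} \<in> sets (sample_measure N \<mu>)" if "\<omega> \<in> {1..N} \<rightarrow>\<^sub>E UNIV" for \<omega>
  proof -
    \<comment> \<open>Samples are extensional functions, fixed outside \<open>{1..N}\<close>, so a
      single sample is a product box.\<close>
    have eq: "{\<omega>} = Pi\<^sub>E {1..N} (\<lambda>i. {\<omega> i})"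
      using that by (simp add: PiE_singleton PiE_iff)
    have "emeasure (sample_measure N \<mu>) {\<omega>} = (\<Prod>i\<in>{1..N}. emeasure (law_measure \<mu>) {\<omega> i})"
      unfolding eq sample_measure_def
      by (rule P.emeasure_PiM) (auto simp: law_measure_def sets_point_measure)
    then show "emeasure (sample_measure N \<mu>) {\<omega>} = ennreal (\<Prod>i=1..N. \<mu> $ \<omega> i)"
      by (simp add: single nn prod_ennreal)
    show "{\<omega>} \<in> sets (sample_measure N \<mu>)"
      unfolding eq sample_measure_def
      by (rule sets_PiM_I_finite) (auto simp: law_measure_def sets_point_measure)
  qed
  have fin: "finite {\<omega> \<in> {1..N} \<rightarrow>\<^sub>E (UNIV :: 'a set). empirical N \<omega> \<in> A}"
    by (rule finite_subset[of _ "{1..N} \<rightarrow>\<^sub>E UNIV"]) (auto intro!: finite_PiE)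
  have "prob_empirical_in N A \<mu> =
      (\<Sum>\<omega>\<in>{\<omega> \<in> {1..N} \<rightarrow>\<^sub>E UNIV. empirical N \<omega> \<in> A}. measure (sample_measure N \<mu>) {\<omega>})"
    unfolding prob_empirical_in_def sp
    by (rule measure_eq_sum_singleton[OF fin]) (auto simp: se em)
  also have "\<dots> = (\<Sum>\<omega>\<in>{\<omega> \<in> {1..N} \<rightarrow>\<^sub>E UNIV. empirical N \<omega> \<in> A}. \<Prod>i=1..N. \<mu> $ \<omega> i)"
    by (rule sum.cong) (auto simp: measure_def em nn prod_nonneg)
  finally show ?thesis .
qed

lemma prob_empirical_in_measurable:
  "prob_empirical_in N A \<in> borel_measurable simplex_borel"
proof -
  have "(\<lambda>\<mu>. \<Sum>\<omega>\<in>{\<omega> \<in> {1..N} \<rightarrow>\<^sub>E UNIV. empirical N \<omega> \<in> A}. \<Prod>i=1..N. \<mu> $ \<omega> i)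
      \<in> borel_measurable simplex_borel"
    by (intro measurable_restrict_space1 borel_measurable_continuous_onI continuous_intros)
  then show ?thesis
    by (rule measurable_cong[THEN iffD1, rotated]) (simp add: prob_empirical_in_eq)
qed

section \<open>Topological supports\<close>

text \<open>A point outside the support has a null open neighbourhood, hence a null basic one;
  countability of the basis keeps the union of all these null.\<close>

lemma AE_msupp:
  fixes M :: "'a::second_countable_topology measure"
  assumes "sets M = sets (restrict_space borel X)"
  shows "AE x in M. x \<in> msupp M"
proof -
  obtain B :: "'a set set" where B: "countable B" "topological_basis B"
    using ex_countable_basis by blast
  define B0 where "B0 = {U \<in> B. emeasure M (U \<inter> space M) = 0}"
  have sp: "space M = X" using sets_eq_imp_space_eq[OF assms] by (simp add: space_restrict_space)
  have meas: "U \<inter> space M \<in> sets M" if "open U" for U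
    using that unfolding assms sp sets_restrict_space by auto
  have "AE x in M. \<forall>U\<in>B0. x \<notin> U"
  proof (rule AE_ball_countable[THEN iffD2])
    show "countable B0" unfolding B0_def using B(1) by simp
    show "\<forall>U\<in>B0. AE x in M. x \<notin> U"
    proof
      fix U assume U: "U \<in> B0"
      then have "U \<inter> space M \<in> null_sets M"
        using meas topological_basis_open[OF B(2)] by (auto simp: B0_def null_sets_def)
      then show "AE x in M. x \<notin> U"
        by (rule AE_I') auto
    qed
  qed
  moreover have "AE x in M. x \<in> space M" by (rule AE_space)
  ultimately show ?thesis
  proof eventually_elim
    case (elim x)
    show ?case unfolding msupp_def
    proof (intro CollectI conjI allI impI)
      fix U assume "open U" "x \<in> U"
      then obtain V where V: "V \<in> B" "x \<in> V" "V \<subseteq> U"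
        using B(2) topological_basisE by metis
      then have "0 < emeasure M (V \<inter> space M)"
        using elim by (auto simp: B0_def zero_less_iff_neq_zero)
      also have "\<dots> \<le> emeasure M (U \<inter> space M)"
        using V meas \<open>open U\<close> by (intro emeasure_mono) auto
      finally show "0 < emeasure M (U \<inter> space M)" .
    qed (use elim in auto)
  qed
qed

lemma msupp_eq_Diff: "msupp M = space M - \<Union>{U. open U \<and> emeasure M (U \<inter> space M) = 0}"
  by (auto simp: msupp_def zero_less_iff_neq_zero)

context
  fixes M :: "(real ^ 'k) measure"
  assumes M: "prob_space M" "sets M = sets simplex_borel"
begin

lemma space_simplex_measure: "space M = prob_simplex"
  using sets_eq_imp_space_eq[OF M(2)] by (simp add: space_restrict_space)

lemma msupp_subset_simplex: "msupp M \<subseteq> prob_simplex"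
  using space_simplex_measure by (auto simp: msupp_def)

lemma compact_msupp: "compact (msupp M)"
  unfolding msupp_eq_Diff space_simplex_measure
  by (intro compact_diff compact_prob_simplex open_Union) auto

lemma AE_in_msupp: "AE x in M. x \<in> msupp M"
  by (rule AE_msupp[OF M(2)])

lemma msupp_nonempty: "msupp M \<noteq> {}"
proof
  assume "msupp M = {}"
  then have "AE x in M. False" using AE_in_msupp by simp
  then show False using prob_space.AE_False[OF M(1)] by simp
qed

text \<open>A disagreement at a support point would persist on a relatively open piece of the
  support, and the corresponding ambient neighbourhood has positive mass. Continuity is asked on the
  support only, so that the lemma applies to the projection there.\<close>

lemma eq_on_msupp_of_AE:
  fixes f :: "real ^ 'k \<Rightarrow> 'b::t1_space"
  assumes cont: "continuous_on (msupp M) f" and AE: "AE x in M. f x = c" and x: "x \<in> msupp M"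
  shows "f x = c"
proof (rule ccontr)
  assume "f x \<noteq> c"
  have "openin (top_of_set (msupp M)) (msupp M \<inter> f -` (- {c}))"
    by (rule continuous_openin_preimage_gen[OF cont]) auto
  then obtain U where U: "open U" "msupp M \<inter> f -` (- {c}) = msupp M \<inter> U"
    by (auto simp: openin_open)
  then have "x \<in> U" using x \<open>f x \<noteq> c\<close> by blast
  then have pos: "0 < emeasure M (U \<inter> space M)" using x U(1) by (auto simp: msupp_def)
  have "AE x in M. x \<notin> U"
    using AE AE_in_msupp by eventually_elim (use U(2) in blast)
  then have "AE x in M. x \<notin> U \<inter> space M" by eventually_elim auto
  moreover have "U \<inter> space M \<in> sets M"
    using U(1) unfolding M(2) space_simplex_measure sets_restrict_space by auto
  ultimately have "emeasure M (U \<inter> space M) = 0"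
    by (simp add: AE_iff_measurable[OF _ refl] AE_iff_null Int_def null_sets_def conj_commute)
  then show False using pos by simp
qed

end

section \<open>Concentration on the minimizers of the rate\<close>

lemma posterior_concentrates:
  fixes prior postE :: "(real ^ 'k) measure" and p :: "nat \<Rightarrow> real ^ 'k \<Rightarrow> real" and R :: "real ^ 'k \<Rightarrow> real"
  assumes prior: "prob_space prior" "sets prior = sets simplex_borel"
    and post: "prob_space postE" "sets postE = sets simplex_borel"
    and p: "\<And>N. p N \<in> borel_measurable simplex_borel"
      "\<And>N \<mu>. 0 \<le> p N \<mu>" "\<And>N \<mu>. \<mu> \<in> prob_simplex \<Longrightarrow> p N \<mu> \<le> 1"
    and R: "continuous_on (msupp prior) R"
    and asymp: "\<And>\<delta>. 0 < \<delta> \<Longrightarrow> \<forall>\<^sub>F N in sequentially. \<forall>\<mu>\<in>msupp prior.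
        exp (- real N * (R \<mu> + \<delta>)) \<le> p N \<mu> \<and> p N \<mu> \<le> exp (- real N * (R \<mu> - \<delta>))"
    and weak: "weakly_converges (\<lambda>N. density prior (\<lambda>\<mu>. ennreal (p N \<mu>) / (\<integral>\<^sup>+ \<nu>. ennreal (p N \<nu>) \<partial>prior))) postE"
  shows "AE \<mu> in postE. \<mu> \<in> msupp prior \<and> (\<forall>\<nu>\<in>msupp prior. R \<mu> \<le> R \<nu>)"
proof -
  interpret prior: prob_space prior by fact
  interpret post: prob_space postE by fact
  define K where "K = msupp prior"
  have K: "compact K" "K \<noteq> {}" unfolding K_def by (intro compact_msupp msupp_nonempty prior)+
  have sub: "K \<subseteq> prob_simplex" unfolding K_def by (rule msupp_subset_simplex[OF prior])
  have sp: "space prior = prob_simplex" "space postE = prob_simplex"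
    by (rule space_simplex_measure[OF prior] space_simplex_measure[OF post])+
  have R: "continuous_on K R" using R by (simp add: K_def)
  obtain \<mu>0 where \<mu>0: "\<mu>0 \<in> K" "\<And>\<nu>. \<nu> \<in> K \<Longrightarrow> R \<mu>0 \<le> R \<nu>"
    using continuous_attains_inf[OF K R] by blast
  have pm [measurable]: "p N \<in> borel_measurable prior" for N
    using p(1)[of N] by (simp cong: measurable_cong_sets add: prior(2))
  have pint: "integrable prior (p N)" for N
    by (rule prior.integrable_const_bound[of _ 1]) (auto simp: p sp)
  define z where "z N = (\<integral>\<nu>. p N \<nu> \<partial>prior)" for N
  have Z: "(\<integral>\<^sup>+ \<nu>. ennreal (p N \<nu>) \<partial>prior) = ennreal (z N)" for N
    unfolding z_def by (intro nn_integral_eq_integral pint) (auto simp: p)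
  have near: "AE \<mu> in postE. \<mu> \<in> K \<and> R \<mu> \<le> R \<mu>0 + \<delta>" if "0 < \<delta>" for \<delta>
  proof -
    define C where "C = {\<mu> \<in> K. R \<mu> \<le> R \<mu>0 + \<delta>}"
    have "C = K \<inter> R -` {..R \<mu>0 + \<delta>}" by (auto simp: C_def)
    then have C: "closed C"
      using continuous_on_closed_vimage[OF compact_imp_closed[OF K(1)], of R] R by (auto simp: Int_commute)
    \<comment> \<open>Membership will be recovered from distance 0, which needs \<open>C\<close>
      closed and nonempty; \<open>infdist\<close> to the empty set is 0 by convention.\<close>
    have C0: "\<mu>0 \<in> C" using \<mu>0 that by (simp add: C_def)
    define f where "f \<mu> = infdist \<mu> C" for \<mu>
    have cf: "continuous_on A f" for A unfolding f_def by (intro continuous_intros)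
    have "bounded (f ` prob_simplex)"
      by (intro compact_imp_bounded compact_continuous_image cf compact_prob_simplex)
    then obtain B where B: "\<And>\<mu>. \<mu> \<in> prob_simplex \<Longrightarrow> norm (f \<mu>) \<le> B"
      by (auto simp: bounded_iff)
    have fm: "f \<in> borel_measurable simplex_borel"
      by (intro measurable_restrict_space1 borel_measurable_continuous_onI cf)
    then have [measurable]: "f \<in> borel_measurable prior" "f \<in> borel_measurable postE"
      by (simp_all cong: measurable_cong_sets add: prior(2) post(2))
    have f0: "0 \<le> f \<mu>" for \<mu> by (simp add: f_def infdist_nonneg)
    \<comment> \<open>Positive mass at a support point is defined through ambient open sets, so the
      relatively open strict sublevel set is written as the trace of some \<open>V\<close>. Points
      of \<open>V\<close> outside \<open>K\<close> form a null set.\<close>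
    have "openin (top_of_set K) (K \<inter> R -` {..<R \<mu>0 + \<delta>/2})"
      by (rule continuous_openin_preimage_gen[OF R]) simp
    then obtain V where V: "open V" "K \<inter> R -` {..<R \<mu>0 + \<delta>/2} = K \<inter> V"
      by (auto simp: openin_open)
    define W where "W = V \<inter> space prior"
    have Ws [measurable]: "W \<in> sets prior"
      using V(1) unfolding W_def prior(2) sp sets_restrict_space by auto
    have "\<mu>0 \<in> V" using V(2) \<mu>0(1) that by auto
    then have "0 < emeasure prior W" using \<mu>0(1) V(1) by (auto simp: K_def msupp_def W_def)
    then have m: "0 < measure prior W" by (simp add: prior.emeasure_eq_measure)
    have AEK: "AE \<mu> in prior. \<mu> \<in> K" unfolding K_def by (rule AE_in_msupp[OF prior])
    have bound: "\<forall>\<^sub>F N in sequentially.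
        (\<integral>\<mu>. f \<mu> \<partial>density prior (\<lambda>\<mu>. ennreal (p N \<mu>) / (\<integral>\<^sup>+ \<nu>. ennreal (p N \<nu>) \<partial>prior)))
          \<in> {0..B / measure prior W * exp (- real N * (\<delta>/4))}"
    proof -
      have "\<forall>\<^sub>F N in sequentially. \<forall>\<mu>\<in>K.
        exp (- real N * (R \<mu> + \<delta>/8)) \<le> p N \<mu> \<and> p N \<mu> \<le> exp (- real N * (R \<mu> - \<delta>/8))"
        unfolding K_def using that by (intro asymp) simp
      then show ?thesis
      proof eventually_elim
        case (elim N)
        \<comment> \<open>On \<open>W\<close> the rate is below \<open>R \<mu>0 + \<delta>/2\<close>
          and the asymptotics cost another \<open>\<delta>/8\<close>: the exponent is at most
          \<open>R \<mu>0 + 5/8 * \<delta>\<close>. Off \<open>C\<close> it is at least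
          \<open>R \<mu>0 + \<delta> - \<delta>/8\<close>. The quotient keeps the margin
          \<open>7/8 - 5/8 = 1/4\<close>.\<close>
        define c where "c = exp (- real N * (R \<mu>0 + 5/8 * \<delta>))"
        have "integrable prior (\<lambda>\<mu>. c * indicator W \<mu>)"
          by (rule prior.integrable_const_bound[of _ c]) (auto simp: c_def indicator_def)
        then have "c * measure prior W = (\<integral>\<mu>. c * indicator W \<mu> \<partial>prior)"
          by simp
        also from \<open>integrable prior (\<lambda>\<mu>. c * indicator W \<mu>)\<close> have "\<dots> \<le> z N"
          unfolding z_def
        proof (rule integral_mono_AE)
          show "AE \<mu> in prior. c * indicator W \<mu> \<le> p N \<mu>"
            using AEK
          proof eventually_elim
            fix \<mu> assume "\<mu> \<in> K"
            show "c * indicator W \<mu> \<le> p N \<mu>"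
            proof (cases "\<mu> \<in> W")
              case True
              then have "R \<mu> < R \<mu>0 + \<delta>/2" using V(2) \<open>\<mu> \<in> K\<close> by (auto simp: W_def)
              then have "real N * (R \<mu> + \<delta>/8) \<le> real N * (R \<mu>0 + 5/8 * \<delta>)"
                by (intro mult_left_mono) auto
              then have "c \<le> exp (- real N * (R \<mu> + \<delta>/8))" by (simp add: c_def)
              also have "\<dots> \<le> p N \<mu>" using elim \<open>\<mu> \<in> K\<close> by blast
              finally show ?thesis using True by simp
            qed (simp add: p)
          qed
        qed (rule pint)
        finally have zc: "c * measure prior W \<le> z N" .
        moreover have "0 < c * measure prior W" using m by (simp add: c_def)
        ultimately have zpos: "0 < z N" by linarith
        have dens: "ennreal (p N \<mu>) / (\<integral>\<^sup>+ \<nu>. ennreal (p N \<nu>) \<partial>prior) = ennreal (p N \<mu> / z N)" for \<mu>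
          unfolding Z using zpos p(2) by (simp add: divide_ennreal)
        have int: "(\<integral>\<mu>. f \<mu> \<partial>density prior (\<lambda>\<mu>. ennreal (p N \<mu>) / (\<integral>\<^sup>+ \<nu>. ennreal (p N \<nu>) \<partial>prior)))
            = (\<integral>\<mu>. p N \<mu> / z N * f \<mu> \<partial>prior)"
          unfolding dens using zpos p(2) by (subst integral_real_density) auto
        have "(\<integral>\<mu>. p N \<mu> / z N * f \<mu> \<partial>prior) \<le>
            (\<integral>\<mu>. B / measure prior W * exp (- real N * (\<delta>/4)) \<partial>prior)"
        proof (rule integral_mono_AE')
          have B0: "0 \<le> B" using B[of \<mu>0] \<mu>0(1) sub by (auto intro: order_trans[OF norm_ge_zero])
          then show "AE \<mu> in prior. 0 \<le> B / measure prior W * exp (- real N * (\<delta>/4))" by simp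
          show "AE \<mu> in prior. p N \<mu> / z N * f \<mu> \<le> B / measure prior W * exp (- real N * (\<delta>/4))"
            using AEK
          proof eventually_elim
            fix \<mu> assume \<mu>: "\<mu> \<in> K"
            show "p N \<mu> / z N * f \<mu> \<le> B / measure prior W * exp (- real N * (\<delta>/4))"
            proof (cases "\<mu> \<in> C")
              case True
              then show ?thesis using B0 by (simp add: f_def infdist_zero)
            next
              case False
              then have "real N * (R \<mu>0 + 7/8 * \<delta>) \<le> real N * (R \<mu> - \<delta>/8)"
                using \<mu> by (intro mult_left_mono) (auto simp: C_def)
              then have "exp (- real N * (R \<mu> - \<delta>/8)) \<le> exp (- real N * (R \<mu>0 + 7/8 * \<delta>))"
                by simp
              also have "\<dots> = c * exp (- real N * (\<delta>/4))"
                unfolding c_def by (simp flip: exp_add add: algebra_simps)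
              finally have "p N \<mu> \<le> c * exp (- real N * (\<delta>/4))"
                using elim \<mu> by (meson order_trans)
              then have "p N \<mu> / z N \<le> c * exp (- real N * (\<delta>/4)) / (c * measure prior W)"
                using zc zpos m p(2) by (intro frac_le) (auto simp: c_def)
              also have "\<dots> = exp (- real N * (\<delta>/4)) / measure prior W"
                by (simp add: c_def)
              finally have "p N \<mu> / z N * f \<mu> \<le> exp (- real N * (\<delta>/4)) / measure prior W * B"
                using B[of \<mu>] \<mu> sub f0 m by (intro mult_mono) auto
              then show ?thesis by (simp add: mult.commute)
            qed
          qed
        qed simp
        then have "(\<integral>\<mu>. p N \<mu> / z N * f \<mu> \<partial>prior) \<le> B / measure prior W * exp (- real N * (\<delta>/4))"
          by (simp add: prior.prob_space)
        moreover have "0 \<le> (\<integral>\<mu>. p N \<mu> / z N * f \<mu> \<partial>prior)"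
          using f0 p(2) zpos by (intro Bochner_Integration.integral_nonneg) auto
        ultimately show ?case unfolding int by simp
      qed
    qed
    have "(\<lambda>N. B / measure prior W * exp (- real N * (\<delta>/4))) \<longlonglongrightarrow> 0"
      using that by real_asymp
    then have "(\<lambda>N. \<integral>\<mu>. f \<mu> \<partial>density prior (\<lambda>\<mu>. ennreal (p N \<mu>) / (\<integral>\<^sup>+ \<nu>. ennreal (p N \<nu>) \<partial>prior)))
        \<longlonglongrightarrow> 0"
      by (rule tendsto_sandwich[OF _ _ tendsto_const, rotated 2])
        (use bound in \<open>auto elim: eventually_mono\<close>)
    moreover have "(\<lambda>N. \<integral>\<mu>. f \<mu> \<partial>density prior (\<lambda>\<mu>. ennreal (p N \<mu>) / (\<integral>\<^sup>+ \<nu>. ennreal (p N \<nu>) \<partial>prior)))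
        \<longlonglongrightarrow> (\<integral>\<mu>. f \<mu> \<partial>postE)"
      using weak cf \<open>bounded (f ` prob_simplex)\<close> unfolding weakly_converges_def sp by blast
    ultimately have "(\<integral>\<mu>. f \<mu> \<partial>postE) = 0"
      using LIMSEQ_unique by blast
    moreover have "integrable postE f"
      by (rule post.integrable_const_bound[of _ B]) (auto simp: sp intro!: AE_I2 B[unfolded real_norm_def])
    ultimately have "AE \<mu> in postE. f \<mu> = 0"
      using integral_nonneg_eq_0_iff_AE[of postE f] f0 by simp
    then show ?thesis
    proof eventually_elim
      case (elim \<mu>)
      then have "\<mu> \<in> C" using in_closed_iff_infdist_zero[OF C] C0 by (auto simp: f_def)
      then show ?case by (simp add: C_def)
    qed
  qed
  \<comment> \<open>Almost-everywhere statements survive countable intersections only, so \<delta>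
    runs through the values \<open>1 / Suc n\<close>.\<close>
  have "AE \<mu> in postE. \<forall>n::nat. \<mu> \<in> K \<and> R \<mu> \<le> R \<mu>0 + 1 / Suc n"
    by (intro AE_all_countable[THEN iffD2] allI near) simp
  then show ?thesis
  proof eventually_elim
    case (elim \<mu>)
    have "R \<mu> \<le> R \<mu>0"
    proof (rule LIMSEQ_le_const)
      show "(\<lambda>n. R \<mu>0 + 1 / Suc n) \<longlonglongrightarrow> R \<mu>0" by real_asymp
    qed (use elim in auto)
    then show ?case using elim \<mu>0 unfolding K_def by (meson order_trans)
  qed
qed

lemma exponential_bounds_of_SUP_tendsto:
  fixes p :: "nat \<Rightarrow> 'a \<Rightarrow> real" and R :: "'a \<Rightarrow> real"
  assumes lim: "(\<lambda>N. SUP \<mu>\<in>K. \<bar>ereal (1 / real N) * log_prob (p N \<mu>) + ereal (R \<mu>)\<bar>) \<longlonglongrightarrow> 0"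
    and "0 < \<delta>"
  shows "\<forall>\<^sub>F N in sequentially. \<forall>\<mu>\<in>K.
      exp (- real N * (R \<mu> + \<delta>)) \<le> p N \<mu> \<and> p N \<mu> \<le> exp (- real N * (R \<mu> - \<delta>))"
proof -
  have "\<forall>\<^sub>F N in sequentially. (SUP \<mu>\<in>K. \<bar>ereal (1 / real N) * log_prob (p N \<mu>) + ereal (R \<mu>)\<bar>) < ereal \<delta>"
    using assms by (intro order_tendstoD(2)[OF lim]) (simp add: zero_ereal_def)
  then show ?thesis
    using eventually_gt_at_top[of 0]
  proof eventually_elim
    case (elim N)
    show ?case
    proof
      fix \<mu> assume \<mu>: "\<mu> \<in> K"
      have *: "\<bar>ereal (1 / real N) * log_prob (p N \<mu>) + ereal (R \<mu>)\<bar> < ereal \<delta>"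
        using elim(1) SUP_upper[OF \<mu>] by (rule le_less_trans[rotated])
      \<comment> \<open>A vanishing probability gives minus infinity, hence an infinite absolute
        value. This relies on \<open>N > 0\<close>: at \<open>N = 0\<close> the factor
        \<open>1 / real N\<close> is 0 and would cancel the infinity.\<close>
      have pos: "0 < p N \<mu>"
      proof (rule ccontr)
        assume "\<not> 0 < p N \<mu>"
        then show False using * elim(2) by (simp add: log_prob_def)
      qed
      then have "\<bar>1 / real N * ln (p N \<mu>) + R \<mu>\<bar> < \<delta>" using * by (simp add: log_prob_def)
      then have "real N * \<bar>1 / real N * ln (p N \<mu>) + R \<mu>\<bar> \<le> real N * \<delta>"
        by (intro mult_left_mono) auto
      then have "\<bar>real N * (1 / real N * ln (p N \<mu>) + R \<mu>)\<bar> \<le> real N * \<delta>" by (simp add: abs_mult)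
      moreover have "real N * (1 / real N * ln (p N \<mu>) + R \<mu>) = ln (p N \<mu>) + real N * R \<mu>"
        using elim(2) by (simp add: distrib_left)
      ultimately have "- real N * (R \<mu> + \<delta>) \<le> ln (p N \<mu>)" "ln (p N \<mu>) \<le> - real N * (R \<mu> - \<delta>)"
        by (auto simp: algebra_simps abs_le_iff)
      then have "exp (- real N * (R \<mu> + \<delta>)) \<le> exp (ln (p N \<mu>))"
        "exp (ln (p N \<mu>)) \<le> exp (- real N * (R \<mu> - \<delta>))" by (simp_all only: exp_le_cancel_iff)
      then show "exp (- real N * (R \<mu> + \<delta>)) \<le> p N \<mu> \<and> p N \<mu> \<le> exp (- real N * (R \<mu> - \<delta>))"
        using pos by simp
    qed
  qed
qed

section \<open>Tilt orbits\<close>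

definition log_vec :: "real ^ 'k \<Rightarrow> real ^ 'k" where
  "log_vec \<mu> = (\<chi> x. ln (\<mu> $ x))"

text \<open>Logarithms turn a tilt into a translation; including the constant function absorbs the
  normalizing factor.\<close>

definition tilt_span :: "nat \<Rightarrow> (nat \<Rightarrow> real ^ 'k) \<Rightarrow> (real ^ 'k) set" where
  "tilt_span r0 g = span (insert 1 (g ` {1..r0}))"

lemma one_in_tilt_span: "1 \<in> tilt_span r0 g"
  unfolding tilt_span_def by (rule span_base) simp

lemma subspace_tilt_span: "subspace (tilt_span r0 g)"
  by (simp add: tilt_span_def)

text \<open>Elements of a span carry coefficients on vectors, tilts carry coefficients on indices;
  injectivity of \<open>g\<close> lets the former be reindexed as the latter.\<close>

lemma in_tilt_span_iff:
  assumes "inj_on g {1..r0}"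
  shows "v \<in> tilt_span r0 g \<longleftrightarrow> (\<exists>\<theta> c. \<forall>x. v $ x = (\<Sum>j=1..r0. \<theta> j * g j $ x) + c)"
proof
  assume "v \<in> tilt_span r0 g"
  then obtain c where "v - c *\<^sub>R 1 \<in> span (g ` {1..r0})"
    unfolding tilt_span_def span_breakdown_eq by blast
  then obtain u where u: "v - c *\<^sub>R 1 = (\<Sum>w\<in>g ` {1..r0}. u w *\<^sub>R w)"
    by (subst (asm) span_finite) auto
  also have "\<dots> = (\<Sum>j=1..r0. u (g j) *\<^sub>R g j)"
    by (subst sum.reindex[OF assms]) (simp add: o_def)
  finally have "v = (\<Sum>j=1..r0. u (g j) *\<^sub>R g j) + c *\<^sub>R 1" by (simp add: algebra_simps)
  then have "\<forall>x. v $ x = (\<Sum>j=1..r0. u (g j) * g j $ x) + c" by simp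
  then show "\<exists>\<theta> c. \<forall>x. v $ x = (\<Sum>j=1..r0. \<theta> j * g j $ x) + c"
    by (intro exI[of _ "\<lambda>j. u (g j)"] exI[of _ c])
next
  assume "\<exists>\<theta> c. \<forall>x. v $ x = (\<Sum>j=1..r0. \<theta> j * g j $ x) + c"
  then obtain \<theta> c where "\<forall>x. v $ x = (\<Sum>j=1..r0. \<theta> j * g j $ x) + c" by blast
  then have "v = (\<Sum>j=1..r0. \<theta> j *\<^sub>R g j) + c *\<^sub>R 1" by (simp add: vec_eq_iff)
  then show "v \<in> tilt_span r0 g"
    unfolding tilt_span_def by (auto intro!: span_add span_sum span_scale intro: span_base)
qed

lemma same_tilt_orbit_iff:
  assumes "inj_on g {1..r0}"
  shows "same_tilt_orbit r0 g \<mu> \<nu> \<longleftrightarrow>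
    \<mu> \<in> pos_laws \<and> \<nu> \<in> pos_laws \<and> log_vec \<nu> - log_vec \<mu> \<in> tilt_span r0 g"
proof -
  have "(\<exists>\<theta>. \<forall>x. \<nu> $ x = \<mu> $ x * exp (\<Sum>j=1..r0. \<theta> j * g j $ x) /
                (\<Sum>y\<in>UNIV. \<mu> $ y * exp (\<Sum>j=1..r0. \<theta> j * g j $ y))) \<longleftrightarrow>
      log_vec \<nu> - log_vec \<mu> \<in> tilt_span r0 g" (is "?L \<longleftrightarrow> ?R")
    if pos: "\<mu> \<in> pos_laws" "\<nu> \<in> pos_laws"
  proof
    have p: "0 < \<mu> $ x" "0 < \<nu> $ x" for x using pos by (auto simp: pos_laws_def)
    {
      assume ?L
      then obtain \<theta> where \<theta>: "\<And>x. \<nu> $ x = \<mu> $ x * exp (\<Sum>j=1..r0. \<theta> j * g j $ x) /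
                (\<Sum>y\<in>UNIV. \<mu> $ y * exp (\<Sum>j=1..r0. \<theta> j * g j $ y))" by blast
      define Z where "Z = (\<Sum>y\<in>UNIV. \<mu> $ y * exp (\<Sum>j=1..r0. \<theta> j * g j $ y))"
      have "0 < Z" unfolding Z_def using p by (intro sum_pos) auto
      then have "ln (\<nu> $ x) = ln (\<mu> $ x) + (\<Sum>j=1..r0. \<theta> j * g j $ x) - ln Z" for x
        unfolding \<theta>[of x] Z_def[symmetric] using p[of x] by (simp add: ln_div ln_mult)
      then have "\<forall>x. (log_vec \<nu> - log_vec \<mu>) $ x = (\<Sum>j=1..r0. \<theta> j * g j $ x) + - ln Z"
        by (simp add: log_vec_def)
      then show ?R unfolding in_tilt_span_iff[OF assms] by blast
    }
    {
      assume ?R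
      then obtain \<theta> c where \<theta>: "\<And>x. ln (\<nu> $ x) - ln (\<mu> $ x) = (\<Sum>j=1..r0. \<theta> j * g j $ x) + c"
        unfolding in_tilt_span_iff[OF assms] by (auto simp: log_vec_def)
      have eq: "\<nu> $ x = \<mu> $ x * exp (\<Sum>j=1..r0. \<theta> j * g j $ x) * exp c" for x
      proof -
        have "ln (\<nu> $ x) = ln (\<mu> $ x) + (\<Sum>j=1..r0. \<theta> j * g j $ x) + c" using \<theta>[of x] by simp
        then have "exp (ln (\<nu> $ x)) = exp (ln (\<mu> $ x)) * exp (\<Sum>j=1..r0. \<theta> j * g j $ x) * exp c"
          by (simp only: exp_add)
        then show ?thesis using p by simp
      qed
      define Z where "Z = (\<Sum>y\<in>UNIV. \<mu> $ y * exp (\<Sum>j=1..r0. \<theta> j * g j $ y))"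
      have "(\<Sum>x\<in>UNIV. \<nu> $ x) = 1" using pos by (simp add: pos_laws_def prob_simplex_def)
      \<comment> \<open>The constant in the span is not a free parameter: both laws have total mass
        1, which forces \<open>exp c\<close> to be the reciprocal of the normalizer.\<close>
      then have 1: "Z * exp c = 1" by (simp add: eq Z_def sum_distrib_right)
      then have "Z \<noteq> 0" by auto
      with 1 have "exp c = 1 / Z" by (simp add: eq_divide_eq mult.commute)
      then have "\<forall>x. \<nu> $ x = \<mu> $ x * exp (\<Sum>j=1..r0. \<theta> j * g j $ x) / Z"
        by (simp add: eq)
      then show ?L unfolding Z_def by blast
    }
  qed
  then show ?thesis unfolding same_tilt_orbit_def by blast
qed

context
  fixes r0 :: nat and g :: "nat \<Rightarrow> real ^ 'k"
  assumes inj: "inj_on g {1..r0}"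
begin

lemma same_tilt_orbit_refl: "\<mu> \<in> pos_laws \<Longrightarrow> same_tilt_orbit r0 g \<mu> \<mu>"
  by (simp add: same_tilt_orbit_iff[OF inj] subspace_0[OF subspace_tilt_span])

lemma same_tilt_orbit_sym: "same_tilt_orbit r0 g \<mu> \<nu> \<Longrightarrow> same_tilt_orbit r0 g \<nu> \<mu>"
  unfolding same_tilt_orbit_iff[OF inj]
  using subspace_neg[OF subspace_tilt_span, of "log_vec \<nu> - log_vec \<mu>" r0 g] by simp

lemma same_tilt_orbit_trans:
  "same_tilt_orbit r0 g \<mu> \<nu> \<Longrightarrow> same_tilt_orbit r0 g \<nu> \<rho> \<Longrightarrow> same_tilt_orbit r0 g \<mu> \<rho>"
  unfolding same_tilt_orbit_iff[OF inj]
  using subspace_add[OF subspace_tilt_span, of "log_vec \<nu> - log_vec \<mu>" r0 g "log_vec \<rho> - log_vec \<nu>"] by simp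

text \<open>Positivity of \<nu> comes for free: if the orbits agree, then \<mu>, a member of its own
  orbit, lies in that of \<nu>, and membership includes positivity of both laws.\<close>

lemma tilt_orbit_eq_iff:
  assumes "\<mu> \<in> pos_laws"
  shows "tilt_orbit r0 g \<mu> = tilt_orbit r0 g \<nu> \<longleftrightarrow> same_tilt_orbit r0 g \<mu> \<nu>"
proof
  assume "tilt_orbit r0 g \<mu> = tilt_orbit r0 g \<nu>"
  then have "same_tilt_orbit r0 g \<nu> \<mu>"
    using same_tilt_orbit_refl[OF assms] by (auto simp: tilt_orbit_def)
  then show "same_tilt_orbit r0 g \<mu> \<nu>" by (rule same_tilt_orbit_sym)
next
  assume "same_tilt_orbit r0 g \<mu> \<nu>"
  then show "tilt_orbit r0 g \<mu> = tilt_orbit r0 g \<nu>"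
    unfolding tilt_orbit_def using same_tilt_orbit_sym same_tilt_orbit_trans by blast
qed

lemma some_in_tilt_orbit:
  assumes "\<mu> \<in> pos_laws"
  shows "same_tilt_orbit r0 g \<mu> (SOME \<nu>. \<nu> \<in> tilt_orbit r0 g \<mu>)"
proof -
  have "\<mu> \<in> tilt_orbit r0 g \<mu>" using same_tilt_orbit_refl[OF assms] by (simp add: tilt_orbit_def)
  then have "(SOME \<nu>. \<nu> \<in> tilt_orbit r0 g \<mu>) \<in> tilt_orbit r0 g \<mu>" by (rule someI)
  then show ?thesis by (simp add: tilt_orbit_def)
qed

end

section \<open>Projection onto an affine set\<close>

context
  fixes r0 :: nat and g :: "nat \<Rightarrow> real ^ 'k" and \<alpha> :: "nat \<Rightarrow> real" and E :: "(real ^ 'k) set"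
  assumes E_affine: "E = {Q \<in> prob_simplex. \<forall>j\<in>{1..r0}. g j \<bullet> Q = \<alpha> j}"
    and E: "compact E" "convex E" "E \<noteq> {}"
    and inj: "inj_on g {1..r0}"
begin

lemma E_subset: "E \<subseteq> prob_simplex"
  by (auto simp: E_affine)

text \<open>Total mass and the equality constraints fix the pairing with each generator, so
  differences of points of \<open>E\<close> are orthogonal to the whole span.\<close>

lemma inner_tilt_span_const:
  assumes "Q \<in> E" "Q' \<in> E" "s \<in> tilt_span r0 g"
  shows "Q \<bullet> s = Q' \<bullet> s"
proof -
  have "orthogonal (Q - Q') s"
    using assms(3) unfolding tilt_span_def
  proof (rule orthogonal_to_span)
    have "Q \<bullet> 1 = 1" if "Q \<in> E" for Q
      using that E_subset by (auto simp: prob_simplex_def inner_vec_def)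
    moreover have "Q \<bullet> g j = \<alpha> j" if "Q \<in> E" "j \<in> {1..r0}" for Q j
      using that by (auto simp: E_affine inner_commute)
    moreover fix y assume "y \<in> insert 1 (g ` {1..r0})"
    ultimately show "orthogonal (Q - Q') y"
      using assms(1,2) by (auto simp: orthogonal_def inner_diff_left)
  qed
  then show ?thesis by (simp add: orthogonal_def inner_diff_left)
qed

lemma I_proj_same_orbit:
  assumes "same_tilt_orbit r0 g \<mu> \<nu>"
  shows "I_proj E \<mu> = I_proj E \<nu>"
proof (rule sym, rule I_proj_eqI[OF E(1,2) E_subset])
  have pos: "\<mu> \<in> pos_laws" "\<nu> \<in> pos_laws" and s: "log_vec \<nu> - log_vec \<mu> \<in> tilt_span r0 g"
    using assms by (auto simp: same_tilt_orbit_iff[OF inj])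
  show "\<nu> \<in> laws_on UNIV" "face E UNIV \<noteq> {}"
    using pos E(3) by (simp_all add: pos_laws_eq_laws_on face_UNIV)
  have T: "I_proj E \<mu> \<in> E"
    using pos by (intro I_proj_in[OF E(1,2) E_subset E(3)]) (simp add: pos_laws_def)
  then show "I_proj E \<mu> \<in> face E UNIV" by (simp add: face_UNIV)
  \<comment> \<open>The change is linear in \<open>Q\<close> with coefficient vector in the tilt
    span, hence the same number for all points of \<open>E\<close>. Coordinates with
    \<open>Q $ x = 0\<close> contribute nothing on either side.\<close>
  have shift: "entropy_sum Q \<nu> = entropy_sum Q \<mu> - Q \<bullet> (log_vec \<nu> - log_vec \<mu>)" if "Q \<in> E" for Q
  proof -
    have "Q $ x * ln (Q $ x / \<nu> $ x) =
        Q $ x * ln (Q $ x / \<mu> $ x) - Q $ x * (log_vec \<nu> - log_vec \<mu>) $ x" for x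
    proof -
      have "0 < \<mu> $ x" "0 < \<nu> $ x" using pos by (auto simp: pos_laws_def)
      moreover have "0 \<le> Q $ x" using that E_subset by (auto simp: prob_simplex_def)
      ultimately show ?thesis
        by (cases "Q $ x = 0") (auto simp: log_vec_def ln_div algebra_simps)
    qed
    then show ?thesis by (simp add: entropy_sum_def inner_vec_def sum_subtractf)
  qed
  fix Q assume "Q \<in> face E UNIV"
  then have Q: "Q \<in> E" by (simp add: face_UNIV)
  have "entropy_sum (I_proj E \<mu>) \<mu> \<le> entropy_sum Q \<mu>"
    using Q pos E(3) I_proj_minimal[OF E(1,2) E_subset, of \<mu> UNIV Q]
    by (simp add: pos_laws_eq_laws_on face_UNIV)
  then show "entropy_sum (I_proj E \<mu>) \<nu> \<le> entropy_sum Q \<nu>"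
    using inner_tilt_span_const[OF T Q s] by (simp add: shift T Q)
qed

text \<open>
  The first-order condition at an interior minimizer says that the gradient \<open>log (P / \<mu>)\<close>, up to a
  constant, annihilates every direction along which \<open>E\<close> extends, so it lies in the span of the constraints.
\<close>

lemma I_proj_in_orbit:
  assumes \<mu>: "\<mu> \<in> pos_laws" and P_pos: "I_proj E \<mu> \<in> pos_laws"
  shows "same_tilt_orbit r0 g \<mu> (I_proj E \<mu>)"
proof -
  define P where "P = I_proj E \<mu>"
  define S where "S = insert 1 (g ` {1..r0})"
  have p: "0 < \<mu> $ x" "0 < P $ x" for x using \<mu> P_pos by (auto simp: pos_laws_def P_def)
  have PE: "P \<in> E" unfolding P_def
    using \<mu> by (intro I_proj_in[OF E(1,2) E_subset E(3)]) (simp add: pos_laws_def)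
  have min: "entropy_sum P \<mu> \<le> entropy_sum Q \<mu>" if "Q \<in> E" for Q
    using that \<mu> E(3) I_proj_minimal[OF E(1,2) E_subset, of \<mu> UNIV Q]
    by (simp add: pos_laws_eq_laws_on face_UNIV P_def)
  have orth: "v \<bullet> (log_vec P - log_vec \<mu>) = 0" if v: "\<And>s. s \<in> S \<Longrightarrow> orthogonal v s" for v
  proof -
    have v1: "(\<Sum>x\<in>UNIV. v $ x) = 0" using v[of 1] by (simp add: S_def orthogonal_def inner_vec_def)
    have vg: "g j \<bullet> v = 0" if "j \<in> {1..r0}" for j
      using v[of "g j"] that by (simp add: S_def orthogonal_def inner_commute)
    have "\<forall>\<^sub>F t in nhds 0. 0 < P $ x + t * v $ x" for x
    proof (rule order_tendstoD(1))
      show "((\<lambda>t. P $ x + t * v $ x) \<longlongrightarrow> P $ x + 0 * v $ x) (nhds 0)"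
        by (intro tendsto_intros filterlim_ident)
    qed (use p in auto)
    then have "\<forall>\<^sub>F t in nhds 0. \<forall>x. 0 < P $ x + t * v $ x" by (rule eventually_all_finite)
    \<comment> \<open>Finitely many positive coordinates leave a common two-sided range of
      \<open>t\<close>. Moving both ways inside \<open>E\<close> makes the derivative at 0 vanish;
      the terms \<open>v $ x\<close> produced by the product rule sum to 0 by
      \<open>v1\<close>.\<close>
    then obtain d where d: "0 < d" "\<And>t x. \<bar>t\<bar> < d \<Longrightarrow> 0 < P $ x + t * v $ x"
      unfolding eventually_nhds_metric by (auto simp: dist_real_def)
    have inE: "P + t *\<^sub>R v \<in> E" if "\<bar>t\<bar> < d" for t
      using d(2)[OF that] PE v1 vg
      by (auto simp: E_affine prob_simplex_def inner_add_right sum.distrib less_imp_le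
          simp flip: sum_distrib_left)
    have "((\<lambda>t. (P $ x + t * v $ x) * ln ((P $ x + t * v $ x) / \<mu> $ x)) has_real_derivative
        v $ x * ln (P $ x / \<mu> $ x) + v $ x) (at 0)" for x
      using p[of x] by (auto intro!: derivative_eq_intros)
    then have "((\<lambda>t. entropy_sum (P + t *\<^sub>R v) \<mu>) has_real_derivative
        (\<Sum>x\<in>UNIV. v $ x * ln (P $ x / \<mu> $ x) + v $ x)) (at 0)"
      unfolding entropy_sum_def by (auto intro!: DERIV_sum)
    then have "(\<Sum>x\<in>UNIV. v $ x * ln (P $ x / \<mu> $ x) + v $ x) = 0"
      by (rule DERIV_local_min[OF _ d(1)]) (auto intro!: min inE)
    moreover have "ln (P $ x / \<mu> $ x) = (log_vec P - log_vec \<mu>) $ x" for x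
      using p[of x] by (simp add: log_vec_def ln_div)
    ultimately show ?thesis using v1 by (simp add: sum.distrib inner_vec_def)
  qed
  \<comment> \<open>The component \<open>z\<close> orthogonal to the generators is itself an
    admissible direction; testing the first-order condition with it gives
    \<open>z \<bullet> z = 0\<close>.\<close>
  obtain y z where yz: "y \<in> span S" "\<And>w. w \<in> span S \<Longrightarrow> orthogonal z w"
      "log_vec P - log_vec \<mu> = y + z"
    using orthogonal_subspace_decomp_exists by metis
  have "z \<bullet> (y + z) = 0"
    unfolding yz(3)[symmetric] by (rule orth) (auto intro: yz span_base)
  moreover have "z \<bullet> y = 0" using yz(2)[OF yz(1)] by (simp add: orthogonal_def)
  ultimately have "z = 0" by (simp add: inner_add_right)
  then have "log_vec P - log_vec \<mu> \<in> tilt_span r0 g"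
    using yz by (simp add: tilt_span_def S_def)
  then show ?thesis
    using \<mu> P_pos by (simp add: same_tilt_orbit_iff[OF inj] P_def)
qed

text \<open>A common projection lies in both orbits, which therefore coincide; the converse is
  invariance along orbits.\<close>

lemma I_proj_eq_iff_same_orbit:
  assumes "\<mu> \<in> pos_laws" "I_proj E \<mu> \<in> pos_laws" "\<nu> \<in> pos_laws" "I_proj E \<nu> \<in> pos_laws"
  shows "I_proj E \<mu> = I_proj E \<nu> \<longleftrightarrow> same_tilt_orbit r0 g \<mu> \<nu>"
  using I_proj_in_orbit[OF assms(1,2)] I_proj_in_orbit[OF assms(3,4)] I_proj_same_orbit
    same_tilt_orbit_sym[OF inj] same_tilt_orbit_trans[OF inj] by metis

end

section \<open>Borel structure on orbits\<close>

lemma sets_restrict_borelI: "A \<in> sets borel \<Longrightarrow> A \<subseteq> X \<Longrightarrow> A \<in> sets (restrict_space borel X)"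
  by (auto simp: sets_restrict_space)

lemma open_sets_orbit_Pow:
  "{U. openin (orbit_space r0 g) U} \<subseteq> Pow (topspace (orbit_space r0 g))"
  using openin_subset by blast

lemma space_orbit_borel: "space (orbit_borel r0 g) = tilt_orbit r0 g ` pos_laws"
  unfolding orbit_borel_def space_measure_of[OF open_sets_orbit_Pow] by (rule topspace_orbit_space)

lemma open_sets_orbit_borel: "openin (orbit_space r0 g) U \<Longrightarrow> U \<in> sets (orbit_borel r0 g)"
  unfolding orbit_borel_def sets_measure_of[OF open_sets_orbit_Pow] by (rule sigma_sets.Basic) simp

lemma measurable_orbit_borelI:
  assumes "f \<in> space M \<rightarrow> tilt_orbit r0 g ` pos_laws"
    and "\<And>U. openin (orbit_space r0 g) U \<Longrightarrow> f -` U \<inter> space M \<in> sets M"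
  shows "f \<in> measurable M (orbit_borel r0 g)"
  unfolding orbit_borel_def
  using assms by (intro measurable_measure_of open_sets_orbit_Pow) (auto simp: topspace_orbit_space)

lemma tilt_orbit_preimage_borel:
  assumes "openin (orbit_space r0 g) U"
  shows "{\<mu> \<in> pos_laws. tilt_orbit r0 g \<mu> \<in> U} \<in> sets borel"
proof -
  obtain V where "open V" "{\<mu> \<in> pos_laws. tilt_orbit r0 g \<mu> \<in> U} = pos_laws \<inter> V"
    using assms unfolding openin_orbit_space openin_open by blast
  then show ?thesis using pos_laws_borel by auto
qed

lemma tilt_orbit_measurable:
  "tilt_orbit r0 g \<in> measurable (restrict_space borel pos_laws) (orbit_borel r0 g)"
proof (rule measurable_orbit_borelI)
  fix U assume U: "openin (orbit_space r0 g) U"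
  have "tilt_orbit r0 g -` U \<inter> pos_laws = {\<mu> \<in> pos_laws. tilt_orbit r0 g \<mu> \<in> U}" by auto
  then show "tilt_orbit r0 g -` U \<inter> space (restrict_space borel pos_laws) \<in> sets (restrict_space borel pos_laws)"
    using tilt_orbit_preimage_borel[OF U]
    by (auto simp: space_restrict_space intro!: sets_restrict_borelI)
qed (simp add: space_restrict_space)

text \<open>Recovering the orbit from the projection calls for a measurable map on the whole
  simplex, so boundary laws are sent to the orbit of a fixed \<mu>0.\<close>

lemma tilt_orbit_extension_measurable:
  assumes "\<mu>0 \<in> pos_laws"
  shows "(\<lambda>P. tilt_orbit r0 g (if P \<in> pos_laws then P else \<mu>0)) \<in> measurable simplex_borel (orbit_borel r0 g)"
proof (rule measurable_orbit_borelI)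
  fix U assume U: "openin (orbit_space r0 g) U"
  let ?A = "{\<mu> \<in> pos_laws. tilt_orbit r0 g \<mu> \<in> U}"
  have "pos_laws \<subseteq> prob_simplex" by (auto simp: pos_laws_def)
  then have "(\<lambda>P. tilt_orbit r0 g (if P \<in> pos_laws then P else \<mu>0)) -` U \<inter> space simplex_borel =
      ?A \<union> (if tilt_orbit r0 g \<mu>0 \<in> U then prob_simplex - pos_laws else {})"
    by (auto split: if_splits)
  moreover have "?A \<subseteq> prob_simplex" by (auto simp: pos_laws_def)
  ultimately show "(\<lambda>P. tilt_orbit r0 g (if P \<in> pos_laws then P else \<mu>0)) -` U \<inter> space simplex_borel
      \<in> sets simplex_borel"
    using tilt_orbit_preimage_borel[OF U] pos_laws_borel prob_simplex_borel
    by (auto intro!: sets_restrict_borelI)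
qed (use assms in auto)

lemma measurable_from_orbit_borel:
  fixes h :: "(real ^ 'k) set \<Rightarrow> real ^ 'm"
  assumes cont: "continuous_map (orbit_space r0 g) euclidean h"
    and range: "h \<in> tilt_orbit r0 g ` pos_laws \<rightarrow> prob_simplex"
  shows "h \<in> measurable (orbit_borel r0 g) simplex_borel"
proof (rule measurable_restrict_space2)
  show "h \<in> space (orbit_borel r0 g) \<rightarrow> prob_simplex" using range by (simp add: space_orbit_borel)
  show "h \<in> measurable (orbit_borel r0 g) borel"
  proof (rule borel_measurableI)
    fix U :: "(real ^ 'm) set" assume "open U"
    then have "openin (orbit_space r0 g) {x \<in> topspace (orbit_space r0 g). h x \<in> U}"
      using cont by (auto simp: continuous_map_def)
    moreover have "{x \<in> topspace (orbit_space r0 g). h x \<in> U} = h -` U \<inter> space (orbit_borel r0 g)"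
      by (auto simp: space_orbit_borel topspace_orbit_space)
    ultimately show "h -` U \<inter> space (orbit_borel r0 g) \<in> sets (orbit_borel r0 g)"
      using open_sets_orbit_borel by metis
  qed
qed

text \<open>\<open>orbit_law\<close> restricts to the positive laws before mapping. On a set of full
  measure, this restriction and a null modification of the map leave the image law
  unchanged.\<close>

lemma distr_restrict_space_AE_cong:
  assumes A: "A \<in> sets M" "AE x in M. x \<in> A"
    and f: "f \<in> measurable (restrict_space M A) N" and f': "f' \<in> measurable M N"
    and eq: "AE x in M. f x = f' x"
  shows "distr (restrict_space M A) N f = distr M N f'"
proof (rule measure_eqI)
  fix B assume "B \<in> sets (distr (restrict_space M A) N f)"
  then have B: "B \<in> sets N" by simp
  have sub: "A \<subseteq> space M" using A(1) sets.sets_into_space by blast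
  have sp: "space (restrict_space M A) = A" using sub by (auto simp: space_restrict_space)
  have m: "f -` B \<inter> A \<in> sets M"
    using measurable_sets[OF f B] sub A(1) unfolding sp by (simp add: sets_restrict_space_iff Int_absorb2)
  have "emeasure (distr (restrict_space M A) N f) B = emeasure (restrict_space M A) (f -` B \<inter> A)"
    using B f by (simp add: emeasure_distr sp)
  also have "\<dots> = emeasure M (f -` B \<inter> A)"
    using A(1) sub by (intro emeasure_restrict_space) (auto simp: Int_absorb2)
  also have "\<dots> = emeasure M (f' -` B \<inter> space M)"
    by (rule emeasure_eq_AE) (use A eq sub m measurable_sets[OF f' B] in auto)
  also have "\<dots> = emeasure (distr M N f') B" using B f' by (simp add: emeasure_distr)
  finally show "emeasure (distr (restrict_space M A) N f) B = emeasure (distr M N f') B" .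
qed simp

section \<open>The orbit space\<close>

text \<open>Inverts \<open>log_vec\<close> up to a constant function, so every logarithmic
  coordinate vector is realized by a positive law.\<close>

definition softmax :: "real ^ 'k \<Rightarrow> real ^ 'k" where
  "softmax w = (\<chi> x. exp (w $ x) / (\<Sum>y\<in>UNIV. exp (w $ y)))"

lemma softmax_pos_laws: "softmax w \<in> pos_laws"
proof -
  have "0 < (\<Sum>y\<in>UNIV. exp (w $ y))" by (intro sum_pos) auto
  then show ?thesis
    by (auto simp: pos_laws_def prob_simplex_def softmax_def less_imp_le simp flip: sum_divide_distrib)
qed

lemma log_vec_softmax: "log_vec (softmax w) = w - ln (\<Sum>y\<in>UNIV. exp (w $ y)) *\<^sub>R 1"
proof -
  have "0 < (\<Sum>y\<in>UNIV. exp (w $ y))" by (intro sum_pos) auto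
  then show ?thesis by (simp add: vec_eq_iff log_vec_def softmax_def ln_div)
qed

lemma continuous_on_softmax: "continuous_on A softmax"
proof -
  have "(\<Sum>y\<in>UNIV. exp (w $ y)) \<noteq> 0" for w :: "real ^ 'a"
    using sum_pos[of UNIV "\<lambda>y. exp (w $ y)"] by auto
  then show ?thesis unfolding softmax_def by (intro continuous_intros) auto
qed

lemma continuous_on_log_vec: "continuous_on pos_laws log_vec"
  unfolding log_vec_def by (intro continuous_intros) (force simp: pos_laws_def order_less_le)

text \<open>
  In logarithmic coordinates tilt orbits are the cosets of \<open>tilt_span\<close>, so the coordinates of \<open>log \<mu>\<close>
  along an orthonormal basis of the orthogonal complement parametrize the orbit space globally.
\<close>

lemma orbit_space_homeomorphic_Euclidean:
  fixes g :: "nat \<Rightarrow> real ^ 'k"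
  assumes rank: "full_rank_mod_constants r0 g"
  shows "orbit_space r0 g homeomorphic_space Euclidean_space (CARD('k) - 1 - r0)"
proof -
  define d where "d = CARD('k) - 1 - r0"
  have inj: "inj_on g {1..r0}" and ind: "1 \<notin> g ` {1..r0}" "independent (insert 1 (g ` {1..r0}))"
    using rank by (auto simp: full_rank_mod_constants_def)
  let ?S = "tilt_span r0 g"
  define W where "W = {w. \<forall>s\<in>?S. orthogonal s w}"
  \<comment> \<open>The \<open>Suc r0\<close> independent generators leave a complement of dimension
    \<open>CARD('k) - Suc r0\<close>, so the truncated subtraction in \<open>d\<close> is
    exact.\<close>
  have "dim ?S = card (insert 1 (g ` {1..r0}))"
    unfolding tilt_span_def by (simp only: dim_span dim_eq_card_independent[OF ind(2)])
  also have "\<dots> = Suc r0" using ind(1) inj by (simp add: card_image)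
  finally have "dim W = d"
    using dim_subspace_orthogonal_to_vectors[OF subspace_tilt_span subspace_UNIV, of r0 g]
    by (simp add: W_def d_def)
  moreover have subW: "subspace W"
    by (auto simp: W_def subspace_def orthogonal_def inner_add_right)
  ultimately obtain B where B: "B \<subseteq> W" "pairwise orthogonal B" "\<And>x. x \<in> B \<Longrightarrow> norm x = 1"
      "independent B" "card B = d" "span B = W"
    using orthonormal_basis_subspace[OF subW] by metis
  have "finite B" using B(4) by (rule independent_imp_finite)
  then obtain b where b: "bij_betw b {0..<d} B"
    using ex_bij_betw_nat_finite[of B] B(5) by auto
  have bB: "b i \<in> B" if "i < d" for i using b that by (auto simp: bij_betw_def)
  have bS: "b i \<bullet> s = 0" if "i < d" "s \<in> ?S" for i s
    using bB[OF that(1)] B(1) that(2) by (auto simp: W_def orthogonal_def inner_commute)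
  have ortho: "b i \<bullet> b j = (if i = j then 1 else 0)" if "i < d" "j < d" for i j
  proof (cases "i = j")
    case True
    then show ?thesis using B(3)[OF bB[OF that(1)]] by (simp add: dot_square_norm)
  next
    case False
    then have "b i \<noteq> b j" using b that by (auto simp: bij_betw_def inj_on_def)
    then show ?thesis using B(2) bB that False by (auto simp: pairwise_def orthogonal_def)
  qed
  \<comment> \<open>Points of \<open>Euclidean_space d\<close> are sequences vanishing from index
    \<open>d\<close> on, hence the default 0.\<close>
  define \<Phi> where "\<Phi> \<mu> = (\<lambda>i. if i < d then b i \<bullet> log_vec \<mu> else 0)" for \<mu>
  \<comment> \<open>The normalizing constant of \<open>softmax\<close> is invisible to \<Phi>,
    because each \<open>b i\<close> is orthogonal to 1.\<close>
  define \<Psi> where "\<Psi> f = softmax (\<Sum>j<d. f j *\<^sub>R b j)" for f :: "nat \<Rightarrow> real"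
  have \<Psi>_pos: "\<Psi> f \<in> pos_laws" for f by (simp add: \<Psi>_def softmax_pos_laws)
  have \<Phi>\<Psi>: "\<Phi> (\<Psi> f) = f" if "f \<in> topspace (Euclidean_space d)" for f
  proof
    fix i
    have "b i \<bullet> (\<Sum>j<d. f j *\<^sub>R b j) = f i" if "i < d"
    proof -
      have "b i \<bullet> (\<Sum>j<d. f j *\<^sub>R b j) = (\<Sum>j<d. if i = j then f j else 0)"
        unfolding inner_sum_right by (rule sum.cong) (use that in \<open>auto simp: ortho\<close>)
      then show ?thesis using that by simp
    qed
    then show "\<Phi> (\<Psi> f) i = f i"
      using that bS[OF _ one_in_tilt_span]
      by (auto simp: \<Phi>_def \<Psi>_def log_vec_softmax inner_diff_right topspace_Euclidean_space)
  qed
  \<comment> \<open>Equal coordinates make the log difference orthogonal to \<open>W\<close>. Its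
    component orthogonal to the tilt span lies in \<open>W\<close>, hence is orthogonal to
    itself.\<close>
  have fibre: "\<Phi> \<mu> = \<Phi> \<nu> \<longleftrightarrow> same_tilt_orbit r0 g \<mu> \<nu>" if pos: "\<mu> \<in> pos_laws" "\<nu> \<in> pos_laws" for \<mu> \<nu>
  proof
    assume "\<Phi> \<mu> = \<Phi> \<nu>"
    then have "\<Phi> \<nu> i = \<Phi> \<mu> i" for i by simp
    then have "b i \<bullet> (log_vec \<nu> - log_vec \<mu>) = 0" if "i < d" for i
      using that unfolding \<Phi>_def inner_diff_right by (metis right_minus_eq)
    moreover have "\<exists>i<d. y = b i" if "y \<in> B" for y using b that by (auto simp: bij_betw_def)
    ultimately have "orthogonal (log_vec \<nu> - log_vec \<mu>) y" if "y \<in> B" for y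
      using that by (metis orthogonal_def inner_commute)
    then have perp: "orthogonal (log_vec \<nu> - log_vec \<mu>) w" if "w \<in> W" for w
      using that B(6) orthogonal_to_span by blast
    obtain y z where yz: "y \<in> span ?S" "\<And>w. w \<in> span ?S \<Longrightarrow> orthogonal z w"
        "log_vec \<nu> - log_vec \<mu> = y + z"
      using orthogonal_subspace_decomp_exists by metis
    have S: "span ?S = ?S" by (simp add: span_eq_iff subspace_tilt_span)
    have "z \<in> W" using yz(2) by (auto simp: W_def S orthogonal_commute)
    then have "(y + z) \<bullet> z = 0" using perp yz(3) by (simp add: orthogonal_def)
    moreover have "y \<bullet> z = 0" using yz(2)[OF yz(1)] by (simp add: orthogonal_def inner_commute)
    ultimately have "z = 0" by (simp add: inner_add_left)
    then show "same_tilt_orbit r0 g \<mu> \<nu>"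
      using yz pos by (simp add: same_tilt_orbit_iff[OF inj] S)
  next
    assume "same_tilt_orbit r0 g \<mu> \<nu>"
    then have diff: "log_vec \<nu> - log_vec \<mu> \<in> ?S" by (simp add: same_tilt_orbit_iff[OF inj])
    have "b i \<bullet> log_vec \<mu> = b i \<bullet> log_vec \<nu>" if "i < d" for i
      using bS[OF that diff] by (simp add: inner_diff_right)
    then show "\<Phi> \<mu> = \<Phi> \<nu>" by (auto simp: \<Phi>_def)
  qed
  \<comment> \<open>Any representative will do, since \<Phi> is constant on orbits; continuity then
    follows from the universal property of the quotient map.\<close>
  define F where "F \<O> = \<Phi> (SOME \<mu>. \<mu> \<in> \<O>)" for \<O> :: "(real ^ 'k) set"
  have F: "F (tilt_orbit r0 g \<mu>) = \<Phi> \<mu>" if "\<mu> \<in> pos_laws" for \<mu>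
    using some_in_tilt_orbit[OF inj that] fibre[OF that]
    unfolding F_def by (metis same_tilt_orbit_iff[OF inj])
  have c\<Phi>: "continuous_map (top_of_set pos_laws) (Euclidean_space d) \<Phi>"
    unfolding \<Phi>_def continuous_map_componentwise_Euclidean_space
    by (auto intro!: continuous_intros continuous_on_log_vec)
  have cF: "continuous_map (orbit_space r0 g) (Euclidean_space d) F"
  proof (rule continuous_compose_quotient_map[OF quotient_map_tilt_orbit])
    show "continuous_map (top_of_set pos_laws) (Euclidean_space d) (F \<circ> tilt_orbit r0 g)"
      using c\<Phi> by (rule continuous_map_eq) (simp add: F)
  qed
  have "continuous_on UNIV \<Psi>"
    unfolding \<Psi>_def
    by (intro continuous_on_compose2[OF continuous_on_softmax[of UNIV]] continuous_intros) auto
  then have "continuous_map (Euclidean_space d) euclidean \<Psi>"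
    unfolding continuous_map_Euclidean_space_iff by (rule continuous_on_subset) simp
  then have c\<Psi>: "continuous_map (Euclidean_space d) (top_of_set pos_laws) \<Psi>"
    by (auto simp: continuous_map_in_subtopology \<Psi>_pos)
  have "homeomorphic_maps (orbit_space r0 g) (Euclidean_space d) F (tilt_orbit r0 g \<circ> \<Psi>)"
    unfolding homeomorphic_maps_def
  proof (intro conjI ballI)
    show "continuous_map (Euclidean_space d) (orbit_space r0 g) (tilt_orbit r0 g \<circ> \<Psi>)"
      by (rule continuous_map_compose[OF c\<Psi> quotient_imp_continuous_map[OF quotient_map_tilt_orbit]])
    show "F ((tilt_orbit r0 g \<circ> \<Psi>) f) = f" if "f \<in> topspace (Euclidean_space d)" for f
      using \<Phi>\<Psi>[OF that] by (simp add: F \<Psi>_pos)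
    fix \<O> assume "\<O> \<in> topspace (orbit_space r0 g)"
    then obtain \<mu> where \<mu>: "\<mu> \<in> pos_laws" "\<O> = tilt_orbit r0 g \<mu>" by (auto simp: topspace_orbit_space)
    have "\<Phi> \<mu> \<in> topspace (Euclidean_space d)" by (simp add: \<Phi>_def topspace_Euclidean_space)
    then have "\<Phi> (\<Psi> (\<Phi> \<mu>)) = \<Phi> \<mu>" by (rule \<Phi>\<Psi>)
    then have "same_tilt_orbit r0 g (\<Psi> (\<Phi> \<mu>)) \<mu>" using fibre[OF \<Psi>_pos \<mu>(1)] by simp
    then show "(tilt_orbit r0 g \<circ> \<Psi>) (F \<O>) = \<O>"
      by (simp add: \<mu>(2) F[OF \<mu>(1)] tilt_orbit_eq_iff[OF inj \<Psi>_pos])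
  qed (rule cF)
  then show ?thesis unfolding d_def homeomorphic_space_def by blast
qed

lemma second_countable_Euclidean_space: "second_countable (Euclidean_space n)"
proof -
  obtain B :: "(nat \<Rightarrow> real) set set" where "countable B" "topological_basis B"
    using ex_countable_basis by blast
  then have "second_countable (euclidean :: (nat \<Rightarrow> real) topology)"
    unfolding second_countable_def
    by (intro exI[of _ B]) (auto simp: topological_basis_open elim!: topological_basisE)
  then show ?thesis
    unfolding Euclidean_space_def euclidean_product_topology[symmetric]
    by (simp add: second_countable_subtopology euclidean_product_topology)
qed

lemma manifold_of_dim_if_homeomorphic_Euclidean:
  assumes "X homeomorphic_space Euclidean_space d"
  shows "manifold_of_dim X d"
  unfolding manifold_of_dim_def
proof (intro conjI ballI)
  show "Hausdorff_space X"
    using homeomorphic_Hausdorff_space[OF assms] Hausdorff_Euclidean_space by simp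
  show "second_countable X"
    using homeomorphic_space_second_countability[OF assms] second_countable_Euclidean_space by simp
  show "\<exists>U V. openin X U \<and> x \<in> U \<and> openin (Euclidean_space d) V \<and>
      subtopology X U homeomorphic_space subtopology (Euclidean_space d) V" if "x \<in> topspace X" for x
    using that assms
    by (intro exI[of _ "topspace X"] exI[of _ "topspace (Euclidean_space d)"]) auto
qed

section \<open>Assembly of support, reachability and degeneracy\<close>

theorem proposition2:
  fixes g :: "nat \<Rightarrow> real ^ 'k" and \<alpha> :: "nat \<Rightarrow> real" and r0 r :: nat
    and \<epsilon> :: "nat \<Rightarrow> real"
    and prior postE :: "(real ^ 'k) measure"
    and E :: "(real ^ 'k) set" and EN :: "nat \<Rightarrow> (real ^ 'k) set"
    and Istar :: ereal and T :: "real ^ 'k \<Rightarrow> real ^ 'k" and pushed :: "(real ^ 'k) measure"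
  assumes "r0 \<le> r"
    and E_def: "E = constraint_set r0 r g \<alpha>"
    and "E \<noteq> {}"
    and "\<And>N. 0 < N \<Longrightarrow> 0 < \<epsilon> N"
    and "\<epsilon> \<longlonglongrightarrow> 0"
    and EN_def: "\<And>N. EN N = relaxed_constraint_set r0 r g \<alpha> (\<epsilon> N)"
    and "prob_space prior" and "sets prior = sets simplex_borel"
    and "prob_space postE" and "sets postE = sets simplex_borel"
    and "weakly_converges (\<lambda>N. constraint_posterior prior N (EN N)) postE"
    and "msupp prior \<subseteq> pos_laws"
    and "(\<lambda>N. SUP \<mu>\<in>msupp prior.
             \<bar>ereal (1 / real N) * log_prob (prob_empirical_in N (EN N) \<mu>) + rate E \<mu>\<bar>)
           \<longlonglongrightarrow> 0"
    and Istar_def: "Istar = (INF \<mu>\<in>msupp prior. rate E \<mu>)"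
    and T_def: "T = I_proj E"
    and pushed_def: "pushed = distr postE simplex_borel T"
  shows
    "\<bar>Istar\<bar> \<noteq> \<infinity> \<and> (\<forall>\<mu>\<in>prob_simplex. rate E \<mu> = 0 \<longleftrightarrow> \<mu> \<in> E) \<and>
     (AE \<mu> in postE. \<mu> \<in> msupp prior \<and> rate E \<mu> = Istar) \<and>
     (Istar = 0 \<longrightarrow>
        (AE \<mu> in postE. \<mu> \<in> E) \<and> (AE \<mu> in postE. T \<mu> = \<mu>) \<and> pushed = postE) \<and>
     (Istar > 0 \<longrightarrow> (AE \<mu> in postE. T \<mu> \<noteq> \<mu>)) \<and>
     (E = {Q \<in> prob_simplex. \<forall>j\<in>{1..r0}. g j \<bullet> Q = \<alpha> j} \<longrightarrow>
      (\<forall>\<mu>\<in>msupp postE. \<mu> \<in> pos_laws \<and> T \<mu> \<in> pos_laws) \<longrightarrow>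
      full_rank_mod_constants r0 g \<longrightarrow>
        (\<forall>\<mu>\<in>msupp postE. \<forall>\<nu>\<in>msupp postE. T \<mu> = T \<nu> \<longleftrightarrow> same_tilt_orbit r0 g \<mu> \<nu>) \<and>
        ((\<exists>P\<in>prob_simplex. pushed = return simplex_borel P) \<longleftrightarrow>
           (\<exists>\<O>\<in>tilt_orbit r0 g ` pos_laws. msupp postE \<subseteq> \<O>)) \<and>
        (\<exists>h h'. h \<in> measurable (orbit_borel r0 g) simplex_borel \<and>
                h' \<in> measurable simplex_borel (orbit_borel r0 g) \<and>
                (\<forall>\<mu>\<in>msupp postE. T \<mu> = h (tilt_orbit r0 g \<mu>) \<and> tilt_orbit r0 g \<mu> = h' (T \<mu>)) \<and>
                pushed = distr (orbit_law r0 g postE) simplex_borel h \<and>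
                orbit_law r0 g postE = distr pushed (orbit_borel r0 g) h') \<and>
        manifold_of_dim (orbit_space r0 g) (CARD('k) - 1 - r0))"
proof -
  note prior = \<open>prob_space prior\<close> \<open>sets prior = sets simplex_borel\<close>
  note post = \<open>prob_space postE\<close> \<open>sets postE = sets simplex_borel\<close>
  interpret post: prob_space postE by (rule post(1))
  have E: "compact E" "convex E" "E \<subseteq> prob_simplex" "E \<noteq> {}"
    using \<open>E \<noteq> {}\<close> unfolding E_def
    by (simp_all add: compact_constraint_set convex_constraint_set constraint_set_subset)
  \<comment> \<open>On the support of the prior the rate is finite, so a continuous real function
    stands in for the extended-real one, and its minimum is attained by compactness.\<close>
  define R where "R \<mu> = entropy_sum (I_proj E \<mu>) \<mu>" for \<mu>
  have rate: "rate E \<mu> = ereal (R \<mu>)" if "\<mu> \<in> msupp prior" for \<mu>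
    using that \<open>msupp prior \<subseteq> pos_laws\<close> unfolding R_def by (intro rate_pos_laws E) auto
  have contR: "continuous_on (msupp prior) R"
    unfolding R_def by (rule continuous_on_subset[OF continuous_on_rate[OF E] \<open>msupp prior \<subseteq> pos_laws\<close>])
  obtain \<mu>0 where \<mu>0: "\<mu>0 \<in> msupp prior" "\<And>\<nu>. \<nu> \<in> msupp prior \<Longrightarrow> R \<mu>0 \<le> R \<nu>"
    using continuous_attains_inf[OF compact_msupp[OF prior] msupp_nonempty[OF prior] contR] by blast
  have Istar: "Istar = ereal (R \<mu>0)"
    unfolding Istar_def
  proof (rule antisym)
    show "(INF \<mu>\<in>msupp prior. rate E \<mu>) \<le> ereal (R \<mu>0)"
      using \<mu>0(1) by (intro INF_lower2[of \<mu>0]) (simp_all add: rate)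
    show "ereal (R \<mu>0) \<le> (INF \<mu>\<in>msupp prior. rate E \<mu>)"
      using \<mu>0(2) by (intro INF_greatest) (simp add: rate)
  qed
  have rate0: "rate E \<mu> = 0 \<longleftrightarrow> \<mu> \<in> E" if "\<mu> \<in> prob_simplex" for \<mu>
    by (rule rate_eq_0_iff[OF E(1-3) that])
  have T_meas [measurable]: "T \<in> measurable postE simplex_borel"
    using I_proj_measurable[OF E] unfolding T_def by (simp cong: measurable_cong_sets add: post(2))
  have sp_post: "space postE = prob_simplex" by (rule space_simplex_measure[OF post])

  have support: "AE \<mu> in postE. \<mu> \<in> msupp prior \<and> rate E \<mu> = Istar"
  proof -
    have "(\<lambda>N. SUP \<mu>\<in>msupp prior. \<bar>ereal (1 / real N) * log_prob (prob_empirical_in N (EN N) \<mu>) + ereal (R \<mu>)\<bar>)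
        \<longlonglongrightarrow> 0"
      using \<open>(\<lambda>N. SUP \<mu>\<in>msupp prior. \<bar>ereal (1 / real N) * log_prob (prob_empirical_in N (EN N) \<mu>) + rate E \<mu>\<bar>)
           \<longlonglongrightarrow> 0\<close> by (simp add: rate cong: SUP_cong)
    note bounds = exponential_bounds_of_SUP_tendsto[OF this]
    have "AE \<mu> in postE. \<mu> \<in> msupp prior \<and> (\<forall>\<nu>\<in>msupp prior. R \<mu> \<le> R \<nu>)"
    proof (rule posterior_concentrates[where p = "\<lambda>N. prob_empirical_in N (EN N)", OF prior post _ _ _ contR bounds])
    qed (use \<open>weakly_converges (\<lambda>N. constraint_posterior prior N (EN N)) postE\<close>
        in \<open>simp_all add: prob_empirical_in_measurable prob_empirical_in_nonneg prob_empirical_in_le_1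
          constraint_posterior_def\<close>)
    then show ?thesis
    proof eventually_elim
      case (elim \<mu>)
      then have "R \<mu> = R \<mu>0" using \<mu>0 by (metis antisym)
      then show ?case using elim by (simp add: rate Istar)
    qed
  qed

  have reachable: "(AE \<mu> in postE. \<mu> \<in> E) \<and> (AE \<mu> in postE. T \<mu> = \<mu>) \<and> pushed = postE" if "Istar = 0"
  proof -
    have inE: "AE \<mu> in postE. \<mu> \<in> E"
      using support
    proof eventually_elim
      case (elim \<mu>)
      then show ?case using that rate0[of \<mu>] msupp_subset_simplex[OF prior] by auto
    qed
    then have fix_AE: "AE \<mu> in postE. T \<mu> = \<mu>"
      by eventually_elim (simp add: T_def I_proj_self[OF E(1-3)])
    have id: "(\<lambda>\<mu>. \<mu>) \<in> measurable postE simplex_borel"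
      by (rule measurable_ident_sets) (simp add: post(2))
    have "pushed = distr postE simplex_borel (\<lambda>\<mu>. \<mu>)"
      unfolding pushed_def by (rule distr_cong_AE[OF refl refl fix_AE T_meas id])
    also have "\<dots> = postE" using post(2) by (intro distr_id2) simp
    finally show ?thesis using inE fix_AE by blast
  qed

  \<comment> \<open>The projection always lies in \<open>E\<close>, whereas a positive minimal rate
    keeps \<mu> outside it.\<close>
  have unreachable: "AE \<mu> in postE. T \<mu> \<noteq> \<mu>" if "Istar > 0"
    using support
  proof eventually_elim
    case (elim \<mu>)
    then have \<mu>: "\<mu> \<in> prob_simplex" using msupp_subset_simplex[OF prior] by auto
    have "rate E \<mu> \<noteq> 0" using elim that by auto
    then have "\<mu> \<notin> E" using rate0[OF \<mu>] by simp
    then show ?case using I_proj_in[OF E \<mu>] unfolding T_def by metis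
  qed

  have degeneracy: "(\<forall>\<mu>\<in>msupp postE. \<forall>\<nu>\<in>msupp postE. T \<mu> = T \<nu> \<longleftrightarrow> same_tilt_orbit r0 g \<mu> \<nu>) \<and>
        ((\<exists>P\<in>prob_simplex. pushed = return simplex_borel P) \<longleftrightarrow>
           (\<exists>\<O>\<in>tilt_orbit r0 g ` pos_laws. msupp postE \<subseteq> \<O>)) \<and>
        (\<exists>h h'. h \<in> measurable (orbit_borel r0 g) simplex_borel \<and>
                h' \<in> measurable simplex_borel (orbit_borel r0 g) \<and>
                (\<forall>\<mu>\<in>msupp postE. T \<mu> = h (tilt_orbit r0 g \<mu>) \<and> tilt_orbit r0 g \<mu> = h' (T \<mu>)) \<and>
                pushed = distr (orbit_law r0 g postE) simplex_borel h \<and>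
                orbit_law r0 g postE = distr pushed (orbit_borel r0 g) h') \<and>
        manifold_of_dim (orbit_space r0 g) (CARD('k) - 1 - r0)"
    if affine: "E = {Q \<in> prob_simplex. \<forall>j\<in>{1..r0}. g j \<bullet> Q = \<alpha> j}"
      and pos: "\<forall>\<mu>\<in>msupp postE. \<mu> \<in> pos_laws \<and> T \<mu> \<in> pos_laws"
      and rank: "full_rank_mod_constants r0 g"
  proof (intro conjI)
    have inj: "inj_on g {1..r0}" using rank by (simp add: full_rank_mod_constants_def)
    note affine = affine E(1,2,4) inj
    have pos: "\<mu> \<in> pos_laws" "T \<mu> \<in> pos_laws" if "\<mu> \<in> msupp postE" for \<mu> using pos that by auto
    have supp_AE: "AE \<mu> in postE. \<mu> \<in> msupp postE" by (rule AE_in_msupp[OF post])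
    have orbit: "same_tilt_orbit r0 g \<mu> (T \<mu>)" if "\<mu> \<in> msupp postE" for \<mu>
      using pos[OF that] I_proj_in_orbit[OF affine] unfolding T_def by blast
    have T_simplex: "T \<mu> \<in> prob_simplex" if "\<mu> \<in> pos_laws" for \<mu>
      using I_proj_in[OF E, of \<mu>] E(3) that by (auto simp: T_def pos_laws_def)
    show iff: "\<forall>\<mu>\<in>msupp postE. \<forall>\<nu>\<in>msupp postE. T \<mu> = T \<nu> \<longleftrightarrow> same_tilt_orbit r0 g \<mu> \<nu>"
      using pos I_proj_eq_iff_same_orbit[OF affine] unfolding T_def by blast
    obtain \<mu>1 where \<mu>1: "\<mu>1 \<in> msupp postE" using msupp_nonempty[OF post] by blast
    have contT: "continuous_on pos_laws T"
      unfolding T_def by (rule continuous_on_I_proj_pos_laws[OF E])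

    show "(\<exists>P\<in>prob_simplex. pushed = return simplex_borel P) \<longleftrightarrow>
        (\<exists>\<O>\<in>tilt_orbit r0 g ` pos_laws. msupp postE \<subseteq> \<O>)"
    proof
      assume "\<exists>P\<in>prob_simplex. pushed = return simplex_borel P"
      then obtain P where P: "P \<in> prob_simplex" "pushed = return simplex_borel P" by blast
      have "AE Q in return simplex_borel P. Q = P"
      proof (rule AE_return[THEN iffD2])
        show "Measurable.pred simplex_borel (\<lambda>Q. Q = P)"
          by (intro measurable_restrict_space1) simp
      qed (use P(1) in simp_all)
      then have "AE \<mu> in postE. T \<mu> = P"
        unfolding P(2)[symmetric] pushed_def by (rule AE_distrD[OF T_meas])
      \<comment> \<open>Continuity of \<open>T\<close> on positive laws upgrades the almost sure
        equality to every support point, where the orbit criterion applies.\<close>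
      then have "T \<mu> = P" if "\<mu> \<in> msupp postE" for \<mu>
        using eq_on_msupp_of_AE[OF post continuous_on_subset[OF contT]] pos that by blast
      then have "msupp postE \<subseteq> tilt_orbit r0 g \<mu>1"
        using iff \<mu>1 by (auto simp: tilt_orbit_def)
      then show "\<exists>\<O>\<in>tilt_orbit r0 g ` pos_laws. msupp postE \<subseteq> \<O>" using pos(1)[OF \<mu>1] by blast
    next
      assume "\<exists>\<O>\<in>tilt_orbit r0 g ` pos_laws. msupp postE \<subseteq> \<O>"
      then have "same_tilt_orbit r0 g \<mu>1 \<mu>" if "\<mu> \<in> msupp postE" for \<mu>
        using that \<mu>1 same_tilt_orbit_sym[OF inj] same_tilt_orbit_trans[OF inj]
        unfolding tilt_orbit_def by blast
      then have const: "T \<mu> = T \<mu>1" if "\<mu> \<in> msupp postE" for \<mu> using iff \<mu>1 that by metis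
      have P: "T \<mu>1 \<in> prob_simplex" using T_simplex pos(1)[OF \<mu>1] .
      have "pushed = distr postE simplex_borel (\<lambda>_. T \<mu>1)"
        unfolding pushed_def
      proof (rule distr_cong_AE[OF refl refl _ T_meas])
        show "AE \<mu> in postE. T \<mu> = T \<mu>1" using supp_AE by eventually_elim (rule const)
      qed (use P in \<open>simp add: measurable_const\<close>)
      also have "\<dots> = return simplex_borel (T \<mu>1)" using P by simp
      finally show "\<exists>P\<in>prob_simplex. pushed = return simplex_borel P" using P by blast
    qed

    \<comment> \<open>Invariance of \<open>T\<close> along orbits makes the choice of representative
      irrelevant.\<close>
    define h where "h \<O> = T (SOME \<mu>. \<mu> \<in> \<O>)" for \<O> :: "(real ^ 'k) set"
    \<comment> \<open>On the support the projection lies in the orbit of \<mu>, so taking its orbit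
      undoes \<open>T\<close>.\<close>
    define h' where "h' P = tilt_orbit r0 g (if P \<in> pos_laws then P else \<mu>1)" for P
    have h: "h (tilt_orbit r0 g \<mu>) = T \<mu>" if "\<mu> \<in> pos_laws" for \<mu>
      using I_proj_same_orbit[OF affine some_in_tilt_orbit[OF inj that]] by (simp add: h_def T_def)
    have h': "h' (T \<mu>) = tilt_orbit r0 g \<mu>" if "\<mu> \<in> msupp postE" for \<mu>
      using tilt_orbit_eq_iff[OF inj pos(1)[OF that], of "T \<mu>"] orbit[OF that] pos(2)[OF that]
      by (simp add: h'_def)
    have h_meas: "h \<in> measurable (orbit_borel r0 g) simplex_borel"
    proof (rule measurable_from_orbit_borel)
      have "continuous_map (top_of_set pos_laws) euclidean (h \<circ> tilt_orbit r0 g)"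
        by (rule continuous_map_eq[of _ _ T]) (simp_all add: contT h)
      then show "continuous_map (orbit_space r0 g) euclidean h"
        by (rule continuous_compose_quotient_map[OF quotient_map_tilt_orbit])
    qed (auto simp: h T_simplex)
    have h'_meas: "h' \<in> measurable simplex_borel (orbit_borel r0 g)"
      unfolding h'_def by (rule tilt_orbit_extension_measurable[OF pos(1)[OF \<mu>1]])
    have pos_sets: "pos_laws \<in> sets postE"
      unfolding post(2) by (intro sets_restrict_borelI pos_laws_borel) (auto simp: pos_laws_def)
    have pos_AE: "AE \<mu> in postE. \<mu> \<in> pos_laws" using supp_AE by eventually_elim (rule pos(1))
    have orbit_meas: "tilt_orbit r0 g \<in> measurable (restrict_space postE pos_laws) (orbit_borel r0 g)"
    proof -
      have "sets (restrict_space postE pos_laws) = sets (restrict_space simplex_borel pos_laws)"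
        by (simp add: sets_restrict_space post(2))
      also have "\<dots> = sets (restrict_space borel (prob_simplex \<inter> pos_laws))"
        by (simp add: restrict_restrict_space prob_simplex_borel pos_laws_borel)
      also have "prob_simplex \<inter> pos_laws = pos_laws" by (auto simp: pos_laws_def)
      finally show ?thesis using tilt_orbit_measurable by (simp cong: measurable_cong_sets)
    qed
    have "pushed = distr (orbit_law r0 g postE) simplex_borel h"
      unfolding pushed_def orbit_law_def distr_distr[OF h_meas orbit_meas]
      using pos_AE
      by (intro distr_restrict_space_AE_cong[symmetric] pos_sets pos_AE T_meas
          measurable_comp[OF orbit_meas h_meas]) (auto simp: h)
    \<comment> \<open>The identity for \<open>h\<close> holds at every positive law, but this one
      uses positivity of the projection, given only on the support; hence \<open>supp_AE\<close> in
      place of \<open>pos_AE\<close>.\<close>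
    moreover have "orbit_law r0 g postE = distr pushed (orbit_borel r0 g) h'"
      unfolding pushed_def orbit_law_def distr_distr[OF h'_meas T_meas]
      using supp_AE
      by (intro distr_restrict_space_AE_cong pos_sets pos_AE orbit_meas
          measurable_comp[OF T_meas h'_meas]) (auto simp: h')
    ultimately show "\<exists>h h'. h \<in> measurable (orbit_borel r0 g) simplex_borel \<and>
                h' \<in> measurable simplex_borel (orbit_borel r0 g) \<and>
                (\<forall>\<mu>\<in>msupp postE. T \<mu> = h (tilt_orbit r0 g \<mu>) \<and> tilt_orbit r0 g \<mu> = h' (T \<mu>)) \<and>
                pushed = distr (orbit_law r0 g postE) simplex_borel h \<and>
                orbit_law r0 g postE = distr pushed (orbit_borel r0 g) h'"
      using h_meas h'_meas h h' pos(1) by (intro exI[of _ h] exI[of _ h']) auto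
    show "manifold_of_dim (orbit_space r0 g) (CARD('k) - 1 - r0)"
      by (intro manifold_of_dim_if_homeomorphic_Euclidean orbit_space_homeomorphic_Euclidean rank)
  qed

  have "\<bar>Istar\<bar> \<noteq> \<infinity>" by (simp add: Istar)
  then show ?thesis
    using rate0 support reachable unreachable degeneracy by blast
qed

end
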